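(* Let $0<M_1<M_2$ and $R_2>R_1>2M_2$. For every sequence $u_n\in\mathcal A_\infty$ with $\mathcal I[u_n]\to\lambda_*$, $$\Xi_{u_n}\xrightarrow{\,w^*\,}\frac{\Delta M}{2}\lambda_*\,\delta_a .$$ Moreover, $$\frac{\Delta M}{2}\lambda_*=4\pi a^2(-p_a),$$ where $p_a$ is the tangential pressure of the Israel surface layer of the metric $g_*$ at $r=a$. Hence the sharp smooth variational cost $\frac{\Delta M}{2}\inf_{\mathcal A_\infty}\mathcal I$ equals the integrated negative Israel surface pressure of the inner layer.
   Context: $\Delta M:=M_2-M_1$. For real $x$, $x_+=\max\{x,0\}$. $\mathcal A_\infty$: functions $u\in C^\infty(\mathbb R)$ with $u\ge0$, $\operatorname{supp}u\subset(R_1,R_2)$, $\int_{R_1}^{R_2}r^2u\,dr=1$. For such $u$ (and likewise for the box profile $u_*$ below): $P_u(r)=\int_{R_1}^r s^2u(s)\,ds$ on $[R_1,R_2]$, extended by $0$ to the left and $1$ to the right; $F_u(r)=1-\frac{2(M_1+\Delta M\,P_u(r))}{r}$; $\mathcal I[u]=\int_{R_1}^{R_2}\frac{r^3(u')_+}{\sqrt{F_u}}\,dr$. $\Xi_u$ is the positive measure on $[R_1,R_2]$ with $d\Xi_u=\frac{\Delta M}{2}\frac{r^3(u')_+}{\sqrt{F_u}}\,dr$ (the negative tangential NEC measure $[-(\rho+p_t)]_+\,dV$). Weak-$*$ convergence is tested against $C([R_1,R_2])$. $A(r)=\frac{R_2^3-r^3}{3}$, $q(r)=\frac{r^{7/2}}{\sqrt{r-2M_1}}$,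 $\Psi=q/A$. $x_0$ is the unique real solution of $M_1x_0^3+3R_2^3x_0-7M_1R_2^3=0$. $a=\max\{R_1,x_0\}$, $\lambda_*=\Psi(a)$ (which equals $\inf_{\mathcal A_\infty}\mathcal I$), $H_*=1/A(a)$, $u_*=H_*\mathbf 1_{(a,R_2)}$, $F_*=F_{u_*}$, $g_*=-F_*dt^2+F_*^{-1}dr^2+r^2d\Omega^2$. Israel layer: on the timelike hypersurface $r=c$ with unit normal $n=\sqrt{F}\,\partial_r$, $K_{AB}=e_A{}^\mu e_B{}^\nu\nabla_\mu n_\nu$ in the tangent directions $(\tau,\theta,\phi)$, $d\tau=\sqrt{F(c)}\,dt$; $[Q]=Q_+-Q_-$; $S^A{}_B=-\frac1{8\pi}([K^A{}_B]-\delta^A{}_B[K])=\operatorname{diag}(-\sigma,p_c,p_c)$. For $g_*$ at $c=a$ this gives $\sigma=0$ and $p_a=\frac{[F_*']_a}{16\pi\sqrt{F_*(a)}}=-\frac{\beta a}{8\pi\sqrt{1-2M_1/a}}$ with $\beta=\Delta M\,H_*$. *)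

theory Defs
  imports "HOL-Probability.Probability"
begin

section \<open>The variational problem\<close>

definition A_infty :: "real \<Rightarrow> real \<Rightarrow> (real \<Rightarrow> real) set" where
  "A_infty R1 R2 = {u. (\<forall>k x. (deriv ^^ k) u differentiable at x) \<and> (\<forall>r. u r \<ge> 0) \<and>
     closure {r. u r \<noteq> 0} \<subseteq> {R1<..<R2} \<and> (LBINT r:{R1..R2}. r\<^sup>2 * u r) = 1}"

definition P_mass :: "real \<Rightarrow> real \<Rightarrow> (real \<Rightarrow> real) \<Rightarrow> real \<Rightarrow> real" where
  "P_mass R1 R2 u r =
     (if r < R1 then 0 else if r > R2 then 1 else (LBINT s:{R1..r}. s\<^sup>2 * u s))"

definition F_met :: "real \<Rightarrow> real \<Rightarrow> real \<Rightarrow> real \<Rightarrow> (real \<Rightarrow> real) \<Rightarrow> real \<Rightarrow> real" where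
  "F_met M1 M2 R1 R2 u r = 1 - 2 * (M1 + (M2 - M1) * P_mass R1 R2 u r) / r"

definition I_fun :: "real \<Rightarrow> real \<Rightarrow> real \<Rightarrow> real \<Rightarrow> (real \<Rightarrow> real) \<Rightarrow> real" where
  "I_fun M1 M2 R1 R2 u =
     (LBINT r:{R1..R2}. r^3 * max (deriv u r) 0 / sqrt (F_met M1 M2 R1 R2 u r))"

definition Xi :: "real \<Rightarrow> real \<Rightarrow> real \<Rightarrow> real \<Rightarrow> (real \<Rightarrow> real) \<Rightarrow> real measure" where
  "Xi M1 M2 R1 R2 u = density (restrict_space lborel {R1..R2})
     (\<lambda>r. ennreal ((M2 - M1) / 2 * (r^3 * max (deriv u r) 0 / sqrt (F_met M1 M2 R1 R2 u r))))"

definition weak_star_tendsto :: "real set \<Rightarrow> (nat \<Rightarrow> real measure) \<Rightarrow> real measure \<Rightarrow> bool" where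
  "weak_star_tendsto S \<mu> \<nu> \<longleftrightarrow>
     (\<forall>\<phi> :: real \<Rightarrow> real. continuous_on S \<phi> \<longrightarrow>
        (\<lambda>n. \<integral>x. \<phi> x \<partial>(\<mu> n)) \<longlonglongrightarrow> (\<integral>x. \<phi> x \<partial>\<nu>))"

definition dirac_on :: "real set \<Rightarrow> real \<Rightarrow> real measure" where
  "dirac_on S a = return (restrict_space borel S) a"

definition A_fun :: "real \<Rightarrow> real \<Rightarrow> real" where
  "A_fun R2 r = (R2^3 - r^3) / 3"

definition q_fun :: "real \<Rightarrow> real \<Rightarrow> real" where
  "q_fun M1 r = r powr (7/2) / sqrt (r - 2 * M1)"

definition Psi :: "real \<Rightarrow> real \<Rightarrow> real \<Rightarrow> real" where
  "Psi M1 R2 r = q_fun M1 r / A_fun R2 r"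

definition x_zero :: "real \<Rightarrow> real \<Rightarrow> real" where
  "x_zero M1 R2 = (THE x. M1 * x^3 + 3 * R2^3 * x - 7 * M1 * R2^3 = 0)"

definition a_star :: "real \<Rightarrow> real \<Rightarrow> real \<Rightarrow> real" where
  "a_star M1 R1 R2 = max R1 (x_zero M1 R2)"

definition lambda_star :: "real \<Rightarrow> real \<Rightarrow> real \<Rightarrow> real" where
  "lambda_star M1 R1 R2 = Psi M1 R2 (a_star M1 R1 R2)"

definition H_star :: "real \<Rightarrow> real \<Rightarrow> real \<Rightarrow> real" where
  "H_star M1 R1 R2 = 1 / A_fun R2 (a_star M1 R1 R2)"

definition u_star :: "real \<Rightarrow> real \<Rightarrow> real \<Rightarrow> real \<Rightarrow> real" where
  "u_star M1 R1 R2 r = H_star M1 R1 R2 * indicator {a_star M1 R1 R2<..<R2} r"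

definition F_star :: "real \<Rightarrow> real \<Rightarrow> real \<Rightarrow> real \<Rightarrow> real \<Rightarrow> real" where
  "F_star M1 M2 R1 R2 = F_met M1 M2 R1 R2 (u_star M1 R1 R2)"

section \<open>The Israel layer of a static spherically symmetric metric\<close>

text \<open>Spacetime points are \<open>x :: real^4\<close> with coordinates \<open>(t, r, \<theta>, \<phi>)\<close> =
  \<open>(x$1, x$2, x$3, x$4)\<close>; points of a hypersurface of constant radius are \<open>y :: real^3\<close> with
  coordinates \<open>(\<tau>, \<theta>, \<phi>)\<close> = \<open>(y$1, y$2, y$3)\<close>.\<close>

definition partial :: "4 \<Rightarrow> (real^4 \<Rightarrow> real) \<Rightarrow> real^4 \<Rightarrow> real" where
  "partial \<mu> f x = deriv (\<lambda>s. f (x + s *\<^sub>R axis \<mu> 1)) 0"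

definition static_metric :: "(real \<Rightarrow> real) \<Rightarrow> real^4 \<Rightarrow> real^4^4" where
  "static_metric F x = (\<chi> \<mu> \<nu>. if \<mu> \<noteq> \<nu> then 0
     else if \<mu> = 1 then - F (x$2)
     else if \<mu> = 2 then 1 / F (x$2)
     else if \<mu> = 3 then (x$2)\<^sup>2
     else (x$2)\<^sup>2 * (sin (x$3))\<^sup>2)"

definition christoffel :: "(real^4 \<Rightarrow> real^4^4) \<Rightarrow> real^4 \<Rightarrow> 4 \<Rightarrow> 4 \<Rightarrow> 4 \<Rightarrow> real" where
  "christoffel g x \<kappa> \<mu> \<nu> = (\<Sum>\<rho>\<in>UNIV. matrix_inv (g x) $ \<kappa> $ \<rho> *
     (partial \<mu> (\<lambda>z. g z $ \<rho> $ \<nu>) x + partial \<nu> (\<lambda>z. g z $ \<rho> $ \<mu>) x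
        - partial \<rho> (\<lambda>z. g z $ \<mu> $ \<nu>) x)) / 2"

definition lower_index :: "(real^4 \<Rightarrow> real^4^4) \<Rightarrow> (real^4 \<Rightarrow> real^4) \<Rightarrow> real^4 \<Rightarrow> real^4" where
  "lower_index g X x = g x *v X x"

definition cov_deriv :: "(real^4 \<Rightarrow> real^4^4) \<Rightarrow> (real^4 \<Rightarrow> real^4) \<Rightarrow> real^4 \<Rightarrow> real^4^4" where
  "cov_deriv g \<omega> x = (\<chi> \<mu> \<nu>. partial \<mu> (\<lambda>z. \<omega> z $ \<nu>) x
     - (\<Sum>\<kappa>\<in>UNIV. christoffel g x \<kappa> \<mu> \<nu> * \<omega> x $ \<kappa>))"

definition unit_normal :: "(real \<Rightarrow> real) \<Rightarrow> real^4 \<Rightarrow> real^4" where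
  "unit_normal F x = sqrt (F (x$2)) *\<^sub>R axis 2 1"

text \<open>The \<open>A\<close>-th row is the tangent vector \<open>e\<^sub>A\<close> to \<open>r = c\<close>; the first one is
  \<open>\<partial>\<^sub>\<tau> = F(c)\<^sup>-\<^sup>1\<^sup>/\<^sup>2 \<partial>\<^sub>t\<close>, since \<open>d\<tau> = sqrt (F c) dt\<close>.\<close>

definition tangent_frame :: "(real \<Rightarrow> real) \<Rightarrow> real \<Rightarrow> real^4^3" where
  "tangent_frame F c = (\<chi> A. if A = 1 then (1 / sqrt (F c)) *\<^sub>R axis 1 1
     else if A = 2 then axis 3 1 else axis 4 1)"

text \<open>The point at radius \<open>r\<close> with the same \<open>t, \<theta>, \<phi>\<close> as the point \<open>y\<close> of the hypersurface
  \<open>r = c\<close>; at \<open>r = c\<close> this is the embedding of the hypersurface.\<close>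

definition layer_point :: "(real \<Rightarrow> real) \<Rightarrow> real \<Rightarrow> real^3 \<Rightarrow> real \<Rightarrow> real^4" where
  "layer_point F c y r = (\<chi> \<mu>. if \<mu> = 1 then y$1 / sqrt (F c)
     else if \<mu> = 2 then r else if \<mu> = 3 then y$2 else y$3)"

definition induced_metric :: "(real \<Rightarrow> real) \<Rightarrow> real \<Rightarrow> real^3 \<Rightarrow> real^3^3" where
  "induced_metric F c y = (\<chi> A B. \<Sum>\<mu>\<in>UNIV. \<Sum>\<nu>\<in>UNIV.
     tangent_frame F c $ A $ \<mu> * tangent_frame F c $ B $ \<nu>
       * static_metric F (layer_point F c y c) $ \<mu> $ \<nu>)"

text \<open>\<open>e\<^sub>A\<^sup>\<mu> e\<^sub>B\<^sup>\<nu> \<nabla>\<^sub>\<mu> n\<^sub>\<nu>\<close> with the derivative evaluated at radius \<open>r\<close>. As \<open>F\<close> may have a kink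
  at \<open>c\<close>, the extrinsic curvatures of the two sides of \<open>r = c\<close> are the limits of this
  as \<open>r\<close> tends to \<open>c\<close> from above and from below.\<close>

definition ext_curv :: "(real \<Rightarrow> real) \<Rightarrow> real \<Rightarrow> real^3 \<Rightarrow> real \<Rightarrow> real^3^3" where
  "ext_curv F c y r = (\<chi> A B. \<Sum>\<mu>\<in>UNIV. \<Sum>\<nu>\<in>UNIV.
     tangent_frame F c $ A $ \<mu> * tangent_frame F c $ B $ \<nu>
       * cov_deriv (static_metric F) (lower_index (static_metric F) (unit_normal F))
           (layer_point F c y r) $ \<mu> $ \<nu>)"

text \<open>\<open>S\<^sup>A\<^sub>B\<close>, from the induced metric and the lower-index extrinsic curvatures of the two sides.\<close>

definition surface_stress :: "real^3^3 \<Rightarrow> real^3^3 \<Rightarrow> real^3^3 \<Rightarrow> real^3^3" where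
  "surface_stress h Kp Km =
     (let J = matrix_inv h ** Kp - matrix_inv h ** Km
      in - (1 / (8 * pi)) *\<^sub>R (J - trace J *\<^sub>R mat 1))"

text \<open>\<open>israel_layer F c \<sigma> p\<close>: the metric with metric function \<open>F\<close> has at \<open>r = c\<close> the Israel layer
  \<open>diag (-\<sigma>, p, p)\<close>. The poles \<open>\<theta> = 0, \<pi>\<close> are excluded as coordinate singularities.\<close>

definition israel_layer :: "(real \<Rightarrow> real) \<Rightarrow> real \<Rightarrow> real \<Rightarrow> real \<Rightarrow> bool" where
  "israel_layer F c \<sigma> p \<longleftrightarrow> 0 < F c \<and> isCont F c \<and>
     (\<forall>y. 0 < y$2 \<and> y$2 < pi \<longrightarrow>
        (\<exists>Kp Km. (ext_curv F c y \<longlongrightarrow> Kp) (at_right c) \<and> (ext_curv F c y \<longlongrightarrow> Km) (at_left c) \<and>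
           surface_stress (induced_metric F c y) Kp Km
             = (\<chi> A B. if A \<noteq> B then 0 else if A = 1 then - \<sigma> else p)))"

lemma israel_layer_unique:
  assumes "israel_layer F c \<sigma> p" and "israel_layer F c \<sigma>' p'"
  shows "\<sigma> = \<sigma>'" and "p = p'"
proof -
  define y :: "real^3" where "y = (\<chi> i. pi / 2)"
  have y: "0 < y$2 \<and> y$2 < pi" by (simp add: y_def)
  obtain Kp Km where 1: "(ext_curv F c y \<longlongrightarrow> Kp) (at_right c)" "(ext_curv F c y \<longlongrightarrow> Km) (at_left c)"
    "surface_stress (induced_metric F c y) Kp Km
       = (\<chi> A B. if A \<noteq> B then 0 else if A = 1 then - \<sigma> else p)"
    using assms(1) y unfolding israel_layer_def by blast
  obtain Kp' Km' where 2: "(ext_curv F c y \<longlongrightarrow> Kp') (at_right c)" "(ext_curv F c y \<longlongrightarrow> Km') (at_left c)"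
    "surface_stress (induced_metric F c y) Kp' Km'
       = (\<chi> A B. if A \<noteq> B then 0 else if A = 1 then - \<sigma>' else p')"
    using assms(2) y unfolding israel_layer_def by blast
  have "Kp = Kp'" using 1(1) 2(1) by (intro tendsto_unique[of "at_right c"]) auto
  moreover have "Km = Km'" using 1(2) 2(2) by (intro tendsto_unique[of "at_left c"]) auto
  ultimately have "(\<chi> A B. if A \<noteq> B then 0 else if A = 1 then - \<sigma> else p)
     = ((\<chi> A B. if A \<noteq> B then 0 else if A = 1 then - \<sigma>' else p') :: real^3^3)"
    using 1(3) 2(3) by simp
  from arg_cong[OF this, of "\<lambda>M. M$1$1"] arg_cong[OF this, of "\<lambda>M. M$2$2"]
  show "\<sigma> = \<sigma>'" "p = p'" by simp_all
qed

end

theory Submission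
  imports Defs
begin

text \<open>Write \<open>w = r\<^sup>3 (u')\<^sub>+ / sqrt F\<^sub>u\<close> for the integrand of \<open>\<I>[u]\<close>. Since the mass function is
  nonnegative, \<open>F\<^sub>u \<le> 1 - 2 M\<^sub>1 / r\<close> and hence \<open>w \<ge> q (u')\<^sub>+\<close>. As \<open>A' = - r\<^sup>2\<close>, the unit mass
  constraint reads \<open>\<integral> A u' = 1\<close>, so \<open>\<integral> A (u')\<^sub>+ \<ge> 1\<close> and
  \<open>\<I>[u] - \<lambda>\<^sub>* \<ge> \<integral> (q - \<lambda>\<^sub>* A) (u')\<^sub>+\<close>. The gap \<open>q - \<lambda>\<^sub>* A\<close> is continuous and nonnegative on \<open>[R\<^sub>1, R\<^sub>2]\<close>
  and vanishes only at \<open>a\<close>, the unique minimum of \<open>\<Psi> = q / A\<close>; therefore a minimizing sequence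
  cannot keep any mass of \<open>(u')\<^sub>+\<close>, and thus of \<open>\<Xi>\<close>, away from \<open>a\<close>. Smoothed boxes that rise in an
  ever thinner layer to the right of \<open>a\<close> show that \<open>\<lambda>\<^sub>*\<close> is the infimum. The Israel layer is a direct
  computation: only the jump of \<open>F\<close>'s derivative contributes, and it is \<open>- 2 \<Delta>M H\<^sub>* a\<close>.\<close>

section \<open>Smooth step functions\<close>

text \<open>Differentiability of order \<open>n\<close> is encoded by existential witnesses for the
  successive derivatives. Sums, products and inverses then follow by induction from the derivative
  rules, and \<open>deriv\<close> enters only in the final translation.\<close>

primrec ndiff :: "nat \<Rightarrow> (real \<Rightarrow> real) \<Rightarrow> bool" where
  "ndiff 0 = (\<lambda>f. True)"
| "ndiff (Suc n) = (\<lambda>f. \<exists>f'. (\<forall>x. (f has_real_derivative f' x) (at x)) \<and> ndiff n f')"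

lemma ndiff_SucI:
  assumes "\<And>x. (f has_real_derivative f' x) (at x)" "ndiff n f'"
  shows "ndiff (Suc n) f"
  using assms by auto

lemma ndiff_SucE:
  assumes "ndiff (Suc n) f"
  obtains f' where "\<And>x. (f has_real_derivative f' x) (at x)" "ndiff n f'"
  using assms by auto

text \<open>The derivatives of products and inverses contain the original functions again, so these
  must be available at the lower order too.\<close>

lemma ndiff_Suc_imp: "ndiff (Suc n) f \<Longrightarrow> ndiff n f"
proof (induction n arbitrary: f)
  case (Suc n)
  obtain f' where "\<And>x. (f has_real_derivative f' x) (at x)" "ndiff (Suc n) f'"
    using Suc.prems by (rule ndiff_SucE) blast
  then show ?case using Suc.IH by (blast intro: ndiff_SucI)
qed simp

lemma ndiff_const: "ndiff n (\<lambda>x. c)"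
proof (induction n arbitrary: c)
  case (Suc n)
  show ?case by (rule ndiff_SucI[where f' = "\<lambda>x. 0"]) (auto intro: Suc)
qed simp

lemma ndiff_add: "ndiff n f \<Longrightarrow> ndiff n g \<Longrightarrow> ndiff n (\<lambda>x. f x + g x)"
proof (induction n arbitrary: f g)
  case (Suc n)
  from Suc.prems obtain f' g' where *: "\<And>x. (f has_real_derivative f' x) (at x)" "ndiff n f'"
    "\<And>x. (g has_real_derivative g' x) (at x)" "ndiff n g'" by (metis ndiff_SucE)
  show ?case
    by (rule ndiff_SucI[where f' = "\<lambda>x. f' x + g' x"]) (auto intro!: Suc.IH * derivative_intros)
qed simp

lemma ndiff_mult: "ndiff n f \<Longrightarrow> ndiff n g \<Longrightarrow> ndiff n (\<lambda>x. f x * g x)"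
proof (induction n arbitrary: f g)
  case (Suc n)
  from Suc.prems obtain f' g' where *: "\<And>x. (f has_real_derivative f' x) (at x)" "ndiff n f'"
    "\<And>x. (g has_real_derivative g' x) (at x)" "ndiff n g'" by (metis ndiff_SucE)
  have "ndiff n f" "ndiff n g" using Suc.prems by (auto dest: ndiff_Suc_imp simp del: ndiff.simps)
  show ?case
    by (rule ndiff_SucI[where f' = "\<lambda>x. f' x * g x + g' x * f x"])
      (auto intro!: Suc.IH * ndiff_add \<open>ndiff n f\<close> \<open>ndiff n g\<close> DERIV_mult)
qed simp

lemma ndiff_inverse: "ndiff n f \<Longrightarrow> (\<And>x. f x \<noteq> 0) \<Longrightarrow> ndiff n (\<lambda>x. inverse (f x))"
proof (induction n arbitrary: f)
  case (Suc n)
  from Suc.prems obtain f' where *: "\<And>x. (f has_real_derivative f' x) (at x)" "ndiff n f'"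
    by (metis ndiff_SucE)
  have "ndiff n f" using Suc.prems(1) by (rule ndiff_Suc_imp)
  show ?case
  \<comment> \<open>The derivative is arranged as a product of inverses so that closure under
    products and the induction hypothesis suffice.\<close>
  proof (rule ndiff_SucI[where f' = "\<lambda>x. (-1) * (inverse (f x) * f' x * inverse (f x))"])
    show "((\<lambda>x. inverse (f x)) has_real_derivative (-1) * (inverse (f x) * f' x * inverse (f x))) (at x)" for x
      using DERIV_inverse'[OF *(1)[of x] Suc.prems(2)] by simp
    show "ndiff n (\<lambda>x. (-1) * (inverse (f x) * f' x * inverse (f x)))"
      by (intro ndiff_mult ndiff_const Suc.IH \<open>ndiff n f\<close> * Suc.prems)
  qed
qed simp

lemma ndiff_affine: "ndiff n f \<Longrightarrow> ndiff n (\<lambda>x. f (c * x + d))"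
proof (induction n arbitrary: f)
  case (Suc n)
  from Suc.prems obtain f' where *: "\<And>x. (f has_real_derivative f' x) (at x)" "ndiff n f'"
    by (metis ndiff_SucE)
  show ?case
    by (rule ndiff_SucI[where f' = "\<lambda>x. f' (c * x + d) * c"])
      (auto intro!: ndiff_mult Suc.IH * ndiff_const DERIV_chain2[OF *(1)] derivative_eq_intros)
qed simp

lemma ndiff_imp_differentiable:
  assumes "\<And>n. ndiff n f"
  shows "(deriv ^^ k) f differentiable at x"
proof -
  \<comment> \<open>The order stays arbitrary in the induction on \<open>k\<close> because every
    application of \<open>deriv\<close> uses up one order.\<close>
  have *: "ndiff n ((deriv ^^ k) f)" for n
  proof (induction k arbitrary: n)
    case (Suc k)
    obtain f' where f': "\<And>x. ((deriv ^^ k) f has_real_derivative f' x) (at x)" "ndiff n f'"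
      using Suc.IH[of "Suc n"] by (metis ndiff_SucE)
    have "deriv ((deriv ^^ k) f) = f'" using f'(1) by (auto intro: DERIV_imp_deriv)
    then show ?case using f'(2) by simp
  qed (use assms in simp)
  from *[of "Suc 0"] show ?thesis unfolding real_differentiable_def by auto
qed

text \<open>The classical flat function exp(-1/x), together with its multiples by powers of 1/x. The
  family is closed under differentiation up to linear combinations, so one induction proves all of
  its members smooth.\<close>

definition flat_exp :: "nat \<Rightarrow> real \<Rightarrow> real" where
  "flat_exp k x = (if x > 0 then (1 / x) ^ k * exp (- (1 / x)) else 0)"

lemma flat_exp_tendsto_0: "(flat_exp k \<longlongrightarrow> 0) (at 0)"
proof -
  have "((\<lambda>x::real. x ^ k / exp x) \<longlongrightarrow> 0) at_top" by (rule tendsto_power_div_exp_0)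
  then have "((\<lambda>x::real. inverse x ^ k / exp (inverse x)) \<longlongrightarrow> 0) (at_right 0)"
    by (rule filterlim_compose) (rule filterlim_inverse_at_top_right)
  then have 1: "(flat_exp k \<longlongrightarrow> 0) (at_right 0)"
    by (rule Lim_transform_eventually)
      (auto simp: eventually_at_filter flat_exp_def exp_minus field_simps)
  have 2: "(flat_exp k \<longlongrightarrow> 0) (at_left 0)"
    by (rule Lim_transform_eventually[OF tendsto_const])
      (auto simp: eventually_at_filter flat_exp_def)
  show ?thesis using 1 2 by (simp add: filterlim_split_at)
qed

lemma flat_exp_has_derivative:
  "(flat_exp k has_real_derivative (flat_exp (k + 2) x - real k * flat_exp (k + 1) x)) (at x)"
proof -
  consider "x > 0" | "x < 0" | "x = 0" by linarith
  then show ?thesis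
  proof cases
    case 1
    have inv: "((\<lambda>x. 1 / x) has_real_derivative - ((1 / x) ^ 2)) (at x)"
      using 1 by (auto intro!: derivative_eq_intros simp: power2_eq_square)
    define e y where "e = exp (- (1 / x))" and "y = 1 / x"
    have "flat_exp j x = y ^ j * e" for j using 1 by (simp add: flat_exp_def e_def y_def)
    then have "flat_exp (k + 2) x - real k * flat_exp (k + 1) x
       = real k * y ^ (k - 1) * (- (y ^ 2)) * e + y ^ k * (e * y ^ 2)"
      \<comment> \<open>The split disposes of the truncated \<open>k - 1\<close>: at
        \<open>k = 0\<close> its term carries the factor zero.\<close>
      by (cases k) (simp_all add: power2_eq_square algebra_simps)
    moreover have "((\<lambda>x. (1 / x) ^ k * exp (- (1 / x))) has_real_derivative
       real k * y ^ (k - 1) * (- (y ^ 2)) * e + y ^ k * (e * y ^ 2)) (at x)"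
      by (rule DERIV_cong[OF DERIV_mult[OF DERIV_power[OF inv, of k]
            DERIV_chain2[OF DERIV_exp DERIV_minus[OF inv]]]]) (simp add: e_def y_def mult_ac)
    ultimately have "((\<lambda>x. (1 / x) ^ k * exp (- (1 / x))) has_real_derivative
       (flat_exp (k + 2) x - real k * flat_exp (k + 1) x)) (at x)"
      by (simp only:)
    then show ?thesis
      by (rule has_field_derivative_transform_within_open[where S = "{0<..}"])
        (use 1 in \<open>auto simp: flat_exp_def\<close>)
  next
    case 2
    have "((\<lambda>x. 0) has_real_derivative (flat_exp (k + 2) x - real k * flat_exp (k + 1) x)) (at x)"
      using 2 by (simp add: flat_exp_def)
    then show ?thesis
      by (rule has_field_derivative_transform_within_open[where S = "{..<0}"])
        (use 2 in \<open>auto simp: flat_exp_def\<close>)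
  next
    case 3
    \<comment> \<open>The difference quotient of \<open>flat_exp k\<close> at the origin is exactly
      \<open>flat_exp (k + 1)\<close>, which tends to zero.\<close>
    have "((\<lambda>h. flat_exp (k + 1) h) \<longlongrightarrow> 0) (at 0)" by (rule flat_exp_tendsto_0)
    then have "((\<lambda>h. (flat_exp k (0 + h) - flat_exp k 0) / h) \<longlongrightarrow> 0) (at 0)"
      by (rule Lim_transform_eventually) (auto simp: eventually_at_filter flat_exp_def)
    then have "(flat_exp k has_real_derivative 0) (at 0)" by (simp add: DERIV_def)
    then show ?thesis using 3 by (simp add: flat_exp_def)
  qed
qed

lemma ndiff_flat_exp: "ndiff n (flat_exp k)"
proof (induction n arbitrary: k)
  case (Suc n)
  have "ndiff n (\<lambda>x. flat_exp (k + 2) x + (- real k) * flat_exp (k + 1) x)"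
    by (intro ndiff_add ndiff_mult ndiff_const Suc)
  then show ?case
    using flat_exp_has_derivative[of k] by (intro ndiff_SucI) auto
qed simp

text \<open>The usual quotient f(x) / (f(x) + f(1 - x)) with f = \<open>flat_exp 0\<close>. Writing
  it with \<open>inverse\<close> and \<open>(-1) * x + 1\<close> matches the closure rules for
  \<open>ndiff\<close>.\<close>

definition smooth_step :: "real \<Rightarrow> real" where
  "smooth_step x = flat_exp 0 x * inverse (flat_exp 0 x + flat_exp 0 ((-1) * x + 1))"

lemma flat_exp_nonneg: "flat_exp k x \<ge> 0"
  by (simp add: flat_exp_def)

text \<open>Of \<open>x\<close> and \<open>1 - x\<close> at least one is positive.\<close>

lemma smooth_step_denom_pos: "flat_exp 0 x + flat_exp 0 ((-1) * x + 1) > 0"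
  by (auto simp: flat_exp_def add_pos_pos)

lemma ndiff_smooth_step: "ndiff n smooth_step"
  unfolding smooth_step_def [abs_def]
  by (intro ndiff_mult ndiff_flat_exp ndiff_inverse ndiff_add ndiff_affine)
    (use smooth_step_denom_pos in \<open>metis less_irrefl\<close>)

lemma smooth_step_eq_0: "x \<le> 0 \<Longrightarrow> smooth_step x = 0"
  by (simp add: smooth_step_def flat_exp_def)

lemma smooth_step_eq_1: "x \<ge> 1 \<Longrightarrow> smooth_step x = 1"
  by (simp add: smooth_step_def flat_exp_def)

lemma smooth_step_nonneg: "smooth_step x \<ge> 0"
  using smooth_step_denom_pos[of x] by (simp add: smooth_step_def flat_exp_nonneg)

lemma smooth_step_le_1: "smooth_step x \<le> 1"
  using smooth_step_denom_pos[of x] flat_exp_nonneg[of 0 "(-1) * x + 1"]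
  by (simp add: smooth_step_def divide_simps)

lemma flat_exp_0_mono: "x \<le> y \<Longrightarrow> flat_exp 0 x \<le> flat_exp 0 y"
  by (auto simp: flat_exp_def frac_le)

lemma smooth_step_mono: "mono smooth_step"
proof (rule monoI)
  fix x y :: real assume "x \<le> y"
  \<comment> \<open>Once the denominators are cleared, the common product of
    \<open>flat_exp 0 x\<close> and \<open>flat_exp 0 y\<close> cancels and this inequality is what
    remains.\<close>
  have "flat_exp 0 x * flat_exp 0 ((-1) * y + 1) \<le> flat_exp 0 y * flat_exp 0 ((-1) * x + 1)"
    using \<open>x \<le> y\<close> by (intro mult_mono flat_exp_0_mono flat_exp_nonneg) auto
  then show "smooth_step x \<le> smooth_step y"
    using smooth_step_denom_pos[of x] smooth_step_denom_pos[of y]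
    by (simp add: smooth_step_def field_simps)
qed

lemma smooth_step_has_derivative:
  obtains s where "\<And>x. (smooth_step has_real_derivative s x) (at x)" "\<And>x. s x \<ge> 0"
    "continuous_on UNIV s" "\<And>x. x \<notin> {0..1} \<Longrightarrow> s x = 0"
proof -
  obtain s where s: "\<And>x. (smooth_step has_real_derivative s x) (at x)" "ndiff 1 s"
    using ndiff_smooth_step[of "Suc 1"] by (metis ndiff_SucE)
  have "continuous_on UNIV s"
    using s(2) by (auto intro!: continuous_at_imp_continuous_on intro: DERIV_isCont)
  moreover have "s x \<ge> 0" for x
    using mono_on_imp_deriv_nonneg[of UNIV smooth_step "s x" x] smooth_step_mono s(1) by auto
  moreover have "s x = 0" if x: "x \<notin> {0..1}" for x
  proof -
    consider "x < 0" | "x > 1" using x by fastforce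
    then have "\<exists>c S. open S \<and> x \<in> S \<and> (\<forall>y\<in>S. smooth_step y = c)"
    proof cases
      case 1
      then show ?thesis by (intro exI[of _ 0] exI[of _ "{..<0}"]) (auto intro: smooth_step_eq_0)
    next
      case 2
      then show ?thesis by (intro exI[of _ 1] exI[of _ "{1<..}"]) (auto intro: smooth_step_eq_1)
    qed
    then obtain c S where "open S" "x \<in> S" "\<And>y. y \<in> S \<Longrightarrow> smooth_step y = c" by blast
    then have "((\<lambda>_. c) has_real_derivative s x) (at x)"
      by (intro has_field_derivative_transform_within_open[OF s(1)]) auto
    then show ?thesis by (rule DERIV_unique) (rule DERIV_const)
  qed
  ultimately show ?thesis by (intro that[of s] s(1))
qed

section \<open>Lower bound and concentration\<close>

lemma set_lborel_integral_continuous: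
  fixes f :: "real \<Rightarrow> real"
  assumes "continuous_on {a..b} f"
  shows "(LBINT x:{a..b}. f x) = integral {a..b} f"
  by (rule set_borel_integral_eq_integral(2)) (rule borel_integrable_atLeastAtMost'[OF assms])

locale mass_shell =
  fixes M1 M2 R1 R2 :: real
  assumes M1_pos: "0 < M1" and M1_less_M2: "M1 < M2" and R1_gt: "2 * M2 < R1"
    and R1_less_R2: "R1 < R2"
begin

abbreviation "a \<equiv> a_star M1 R1 R2"
abbreviation "lam \<equiv> lambda_star M1 R1 R2"
abbreviation "A \<equiv> A_fun R2"
abbreviation "q \<equiv> q_fun M1"
abbreviation "F \<equiv> F_met M1 M2 R1 R2"
abbreviation "P \<equiv> P_mass R1 R2"
abbreviation "cubic x \<equiv> M1 * x ^ 3 + 3 * R2 ^ 3 * x - 7 * M1 * R2 ^ 3"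

section \<open>Location of the minimum of \<open>Psi\<close>\<close>

lemma R2_pos: "R2 > 0" and R1_pos: "R1 > 0" and R1_gt1: "R1 > 2 * M1" and R2_gt: "R2 > 2 * M1"
  using M1_pos M1_less_M2 R1_gt R1_less_R2 by auto

lemma cubic_strict_mono: "x < y \<Longrightarrow> cubic x < cubic y"
proof -
  assume "x < y"
  have "M1 * x ^ 3 \<le> M1 * y ^ 3"
    using \<open>x < y\<close> M1_pos by (intro mult_left_mono power_mono_odd) auto
  moreover have "3 * R2 ^ 3 * x < 3 * R2 ^ 3 * y" using \<open>x < y\<close> R2_pos by simp
  ultimately show ?thesis by linarith
qed

text \<open>At \<open>2 * M1\<close> the cubic equals M1 ((2 M1)^3 - R2^3) < 0 and at
  \<open>R2\<close> it equals 3 R2^3 (R2 - 2 M1) > 0, so a root lies between. Strict monotonicity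
  makes it unique, which is what gives the definite description its value.\<close>

lemma x_zero:
  shows x_zero_root: "cubic (x_zero M1 R2) = 0"
    and x_zero_gt: "x_zero M1 R2 > 2 * M1" and x_zero_less: "x_zero M1 R2 < R2"
proof -
  have "(2 * M1) ^ 3 < R2 ^ 3" using R2_gt M1_pos by (intro power_strict_mono) auto
  then have "M1 * ((2 * M1) ^ 3 - R2 ^ 3) < 0" using M1_pos by (intro mult_pos_neg) auto
  then have 1: "cubic (2 * M1) < 0" by (simp add: algebra_simps)
  have "3 * R2 ^ 3 * (R2 - 2 * M1) > 0" using R2_pos R2_gt by (intro mult_pos_pos) auto
  then have 2: "cubic R2 > 0" by (simp add: algebra_simps)
  obtain x where x: "2 * M1 \<le> x" "x \<le> R2" "cubic x = 0"
  proof -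
    have "\<exists>x\<ge>2 * M1. x \<le> R2 \<and> cubic x = 0"
      by (rule IVT'[OF less_imp_le[OF 1] less_imp_le[OF 2] less_imp_le[OF R2_gt]])
        (intro continuous_intros)
    then show thesis using that by blast
  qed
  have uniq: "y = x" if "cubic y = 0" for y
    using cubic_strict_mono[of x y] cubic_strict_mono[of y x] x(3) that
    by (cases x y rule: linorder_cases) auto
  have eq: "x_zero M1 R2 = x"
    unfolding x_zero_def by (rule the_equality, rule x(3)) (rule uniq)
  have "x \<noteq> 2 * M1" using x(3) 1 by (metis less_irrefl)
  moreover have "x \<noteq> R2" using x(3) 2 by (metis less_irrefl)
  ultimately show "cubic (x_zero M1 R2) = 0" "x_zero M1 R2 > 2 * M1" "x_zero M1 R2 < R2"
    unfolding eq using x by (simp_all only: less_le) blast+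
qed

lemma a_bounds: "R1 \<le> a" "a < R2" "0 < a" "2 * M1 < a"
  using x_zero_less R1_less_R2 R1_pos R1_gt1 by (auto simp: a_star_def)

lemma A_pos: "0 \<le> r \<Longrightarrow> r < R2 \<Longrightarrow> A r > 0"
  by (simp add: A_fun_def power_strict_mono)

lemma A_deriv: "(A has_real_derivative - (r\<^sup>2)) (at r)"
  unfolding A_fun_def [abs_def] by (auto intro!: derivative_eq_intros)

text \<open>This exhibits \<open>q\<close> as the factor r^3 / sqrt F for the largest metric
  function possible, the one with no shell mass inside radius \<open>r\<close>.\<close>

lemma q_eq:
  assumes "r > 2 * M1"
  shows "q r = r ^ 3 / sqrt (1 - 2 * M1 / r)"
proof -
  have r: "r > 0" using assms M1_pos by linarith
  have "r powr (7/2) = r powr 3 * r powr (1/2)" by (simp flip: powr_add)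
  also have "\<dots> = r ^ 3 * sqrt r" using r by (simp add: powr_half_sqrt powr_numeral)
  finally have "r powr (7/2) = r ^ 3 * sqrt r" .
  moreover have "1 - 2 * M1 / r = (r - 2 * M1) / r" using r by (simp add: field_simps)
  ultimately show ?thesis using r assms by (simp add: q_fun_def real_sqrt_divide)
qed

lemma q_pos: "r > 2 * M1 \<Longrightarrow> q r > 0"
  using M1_pos by (simp add: q_fun_def)

text \<open>The logarithm of \<open>Psi\<close> has a rational derivative whose numerator is the
  cubic defining \<open>x_zero\<close>; its monotonicity can thus be read off from the sign of the
  cubic.\<close>

definition lnPsi :: "real \<Rightarrow> real" where
  "lnPsi r = 7/2 * ln r - 1/2 * ln (r - 2 * M1) - ln (A r)"

lemma exp_lnPsi:
  assumes "2 * M1 < r" "r < R2"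
  shows "exp (lnPsi r) = Psi M1 R2 r"
proof -
  have r: "r > 0" using assms M1_pos by linarith
  have "exp (7/2 * ln r) = r powr (7/2)" using r by (simp add: powr_def)
  moreover have "exp (1/2 * ln (r - 2 * M1)) = sqrt (r - 2 * M1)"
    using assms powr_half_sqrt[of "r - 2 * M1"] by (simp add: powr_def)
  moreover have "exp (ln (A r)) = A r" using A_pos[of r] r assms by simp
  ultimately show ?thesis by (simp add: lnPsi_def exp_diff Psi_def q_fun_def)
qed

lemma lnPsi_deriv:
  assumes "2 * M1 < r" "r < R2"
  shows "(lnPsi has_real_derivative cubic r / (r * (r - 2 * M1) * (R2 ^ 3 - r ^ 3))) (at r)"
proof -
  have r: "r > 0" using assms M1_pos by linarith
  have "R2 ^ 3 - r ^ 3 > 0" using A_pos[of r] r assms by (simp add: A_fun_def)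
  then have nz: "r \<noteq> 0" "r - 2 * M1 \<noteq> 0" "R2 ^ 3 - r ^ 3 \<noteq> 0" using r assms by auto
  have "7/2 * (1/r) - 1/2 * (1/(r - 2 * M1)) + 3 * r\<^sup>2 / (R2 ^ 3 - r ^ 3)
     = cubic r / (r * (r - 2 * M1) * (R2 ^ 3 - r ^ 3))"
  proof -
    \<comment> \<open>Generic \<open>w\<close> and \<open>D\<close> keep the two factors unexpanded
      while the fractions are brought to a common denominator.\<close>
    have *: "7/2 * (1/r) - 1/2 * (1/w) + 3 * r\<^sup>2 / D = (7 * w * D - r * D + 6 * r ^ 3 * w) / (2 * (r * w * D))"
      if "w \<noteq> 0" "D \<noteq> 0" for w D :: real
      using nz(1) that by (simp add: field_simps power2_eq_square power3_eq_cube)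
    have "7 * (r - 2 * M1) * (R2 ^ 3 - r ^ 3) - r * (R2 ^ 3 - r ^ 3) + 6 * r ^ 3 * (r - 2 * M1) = 2 * cubic r"
      by (simp add: algebra_simps)
    then show ?thesis unfolding *[OF nz(2,3)] by (simp only: mult_divide_mult_cancel_left)
  qed
  moreover have "(lnPsi has_real_derivative
      7/2 * (1/r) - 1/2 * (1/(r - 2 * M1)) + 3 * r\<^sup>2 / (R2 ^ 3 - r ^ 3)) (at r)"
  proof -
    have "((\<lambda>r. ln (r - 2 * M1)) has_real_derivative 1 / (r - 2 * M1)) (at r)"
      using assms by (auto intro!: derivative_eq_intros)
    moreover have "((\<lambda>r. ln (A r)) has_real_derivative 1 / A r * (- (r\<^sup>2))) (at r)"
      using A_pos[of r] r assms by (intro DERIV_chain2[OF DERIV_ln_divide A_deriv]) auto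
    ultimately show ?thesis
      unfolding lnPsi_def [abs_def]
      by (rule DERIV_cong[OF DERIV_diff[OF DERIV_diff[OF DERIV_cmult[OF DERIV_ln_divide[OF r]]
              DERIV_cmult]]]) (simp add: A_fun_def)
  qed
  ultimately show ?thesis by (simp only:)
qed

lemma lnPsi_deriv_denom_pos:
  assumes "2 * M1 < r" "r < R2"
  shows "r * (r - 2 * M1) * (R2 ^ 3 - r ^ 3) > 0"
proof -
  have "r > 0" using assms M1_pos by linarith
  then show ?thesis using A_pos[of r] assms by (simp add: A_fun_def)
qed

lemma lnPsi_isCont: "2 * M1 < r \<Longrightarrow> r < R2 \<Longrightarrow> isCont lnPsi r"
  using lnPsi_deriv by (blast intro: DERIV_isCont)

text \<open>The derivative of \<open>lnPsi\<close> has the sign of the cubic, negative before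
  \<open>x_zero\<close> and positive after it. Hence \<open>lnPsi\<close> decreases strictly up to
  \<open>a\<close> and increases strictly from there.\<close>

lemma lam_less_Psi:
  assumes "R1 \<le> r" "r < R2" "r \<noteq> a"
  shows "lam < Psi M1 R2 r"
proof -
  have "lnPsi a < lnPsi r"
  proof (cases "a < r")
    case True
    show ?thesis
    proof (rule DERIV_pos_imp_increasing_open[OF True])
      fix t assume t: "a < t" "t < r"
      have "cubic (x_zero M1 R2) < cubic t"
        using t by (intro cubic_strict_mono) (simp add: a_star_def)
      then have "cubic t / (t * (t - 2 * M1) * (R2 ^ 3 - t ^ 3)) > 0"
        using x_zero_root lnPsi_deriv_denom_pos[of t] t a_bounds assms
        by (intro divide_pos_pos) auto
      then show "\<exists>y. (lnPsi has_real_derivative y) (at t) \<and> 0 < y"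
        using lnPsi_deriv[of t] t a_bounds assms by auto
    next
      show "continuous_on {a..r} lnPsi"
        using a_bounds assms by (intro continuous_at_imp_continuous_on ballI lnPsi_isCont) auto
    qed
  next
    case False
    then have "r < a" using assms by simp
    \<comment> \<open>A radius in the domain strictly below \<open>a\<close> excludes
      \<open>a = R1\<close>.\<close>
    then have a: "a = x_zero M1 R2" using assms by (auto simp: a_star_def max_def split: if_splits)
    show ?thesis
    proof (rule DERIV_neg_imp_decreasing_open[OF \<open>r < a\<close>])
      fix t assume t: "r < t" "t < a"
      have "cubic t < cubic (x_zero M1 R2)"
        using t a by (intro cubic_strict_mono) simp
      then have "cubic t / (t * (t - 2 * M1) * (R2 ^ 3 - t ^ 3)) < 0"
        using x_zero_root lnPsi_deriv_denom_pos[of t] t a_bounds assms R1_gt1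
        by (intro divide_neg_pos) auto
      then show "\<exists>y. (lnPsi has_real_derivative y) (at t) \<and> y < 0"
        using lnPsi_deriv[of t] t a_bounds assms R1_gt1 by auto
    next
      show "continuous_on {r..a} lnPsi"
        using a_bounds assms R1_gt1
        by (intro continuous_at_imp_continuous_on ballI lnPsi_isCont) auto
    qed
  qed
  then have "exp (lnPsi a) < exp (lnPsi r)" by simp
  then show ?thesis
    using exp_lnPsi[of a] exp_lnPsi[of r] a_bounds assms R1_gt1 by (simp add: lambda_star_def)
qed

lemma lam_pos: "lam > 0"
  unfolding lambda_star_def Psi_def using q_pos[of a] A_pos[of a] a_bounds by simp

definition gap :: "real \<Rightarrow> real" where "gap r = q r - lam * A r"

lemma gap_pos:
  assumes "R1 \<le> r" "r \<le> R2" "r \<noteq> a"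
  shows "gap r > 0"
\<comment> \<open>At \<open>R2\<close> the denominator of \<open>Psi\<close> vanishes, so the
  comparison with \<open>lam\<close> says nothing there; the gap is simply
  \<open>q R2\<close>.\<close>
proof (cases "r = R2")
  case True
  then show ?thesis using q_pos[of R2] R2_gt by (simp add: gap_def A_fun_def)
next
  case False
  then have "A r > 0" using A_pos assms R1_pos by simp
  then show ?thesis
    using lam_less_Psi[of r] assms False by (simp add: gap_def Psi_def field_simps)
qed

lemma gap_nonneg: "R1 \<le> r \<Longrightarrow> r \<le> R2 \<Longrightarrow> gap r \<ge> 0"
proof (cases "r = a")
  case True
  then show ?thesis using A_pos[of a] a_bounds by (simp add: gap_def lambda_star_def Psi_def)
qed (use gap_pos in \<open>auto intro: less_imp_le\<close>)

lemma q_continuous: "continuous_on {R1..R2} q"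
  unfolding q_fun_def [abs_def] using R1_gt1 R1_pos M1_pos
  by (auto intro!: continuous_intros)

lemma A_continuous: "continuous_on S A"
  unfolding A_fun_def [abs_def] by (intro continuous_intros) auto

lemma gap_continuous: "continuous_on {R1..R2} gap"
  unfolding gap_def [abs_def] by (intro continuous_intros q_continuous A_continuous)


section \<open>Admissible profiles and bounds on their metric functions\<close>

lemma A_inftyD:
  assumes "u \<in> A_infty R1 R2"
  shows A_infty_deriv: "(u has_real_derivative deriv u r) (at r)"
    and A_infty_continuous: "continuous_on S u"
    and A_infty_deriv_continuous: "continuous_on S (deriv u)"
    and A_infty_nonneg: "u r \<ge> 0"
    and A_infty_R1: "u R1 = 0" and A_infty_R2: "u R2 = 0"
    and A_infty_mass: "integral {R1..R2} (\<lambda>r. r\<^sup>2 * u r) = 1"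
proof -
  have diff: "(deriv ^^ k) u differentiable at x" for k x using assms by (simp add: A_infty_def)
  show "(u has_real_derivative deriv u r) (at r)" for r
    using diff[of 0 r] by (simp add: DERIV_deriv_iff_real_differentiable)
  show cont: "continuous_on S u" for S
    using diff[of 0] by (auto intro!: continuous_at_imp_continuous_on differentiable_imp_continuous_within)
  show "continuous_on S (deriv u)"
    using diff[of 1] by (auto intro!: continuous_at_imp_continuous_on differentiable_imp_continuous_within)
  show "u r \<ge> 0" using assms by (simp add: A_infty_def)
  have *: "r \<in> {R1<..<R2}" if "u r \<noteq> 0" for r
    using assms that closure_subset[of "{r. u r \<noteq> 0}"] by (auto simp: A_infty_def)
  show "u R1 = 0" "u R2 = 0" using *[of R1] *[of R2] by auto
  have "continuous_on {R1..R2} (\<lambda>r. r\<^sup>2 * u r)" by (intro continuous_intros cont)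
  then show "integral {R1..R2} (\<lambda>r. r\<^sup>2 * u r) = 1"
    using assms set_lborel_integral_continuous by (simp add: A_infty_def)
qed

lemma P_eq:
  assumes "u \<in> A_infty R1 R2" "R1 \<le> r" "r \<le> R2"
  shows "P u r = integral {R1..r} (\<lambda>s. s\<^sup>2 * u s)"
proof -
  have "continuous_on {R1..r} (\<lambda>s. s\<^sup>2 * u s)"
    by (intro continuous_intros A_infty_continuous assms(1))
  then show ?thesis using assms set_lborel_integral_continuous by (simp add: P_mass_def)
qed

lemma
  assumes u: "u \<in> A_infty R1 R2"
  shows P_continuous: "continuous_on {R1..R2} (P u)"
    and P_nonneg: "\<And>r. R1 \<le> r \<Longrightarrow> r \<le> R2 \<Longrightarrow> 0 \<le> P u r"
    and P_le_1: "\<And>r. R1 \<le> r \<Longrightarrow> r \<le> R2 \<Longrightarrow> P u r \<le> 1"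
proof -
  have int: "(\<lambda>s. s\<^sup>2 * u s) integrable_on {x..y}" for x y
    using A_infty_continuous[OF u] by (intro integrable_continuous_real continuous_intros)
  have "continuous_on {R1..R2} (\<lambda>r. integral {R1..r} (\<lambda>s. s\<^sup>2 * u s))"
    by (rule indefinite_integral_continuous_1[OF int])
  then show "continuous_on {R1..R2} (P u)"
    by (rule continuous_on_eq) (use P_eq[OF u] in auto)
  fix r assume r: "R1 \<le> r" "r \<le> R2"
  show "0 \<le> P u r"
    unfolding P_eq[OF u r] by (rule integral_nonneg[OF int]) (use A_infty_nonneg[OF u] in auto)
  have "integral {R1..r} (\<lambda>s. s\<^sup>2 * u s) \<le> integral {R1..R2} (\<lambda>s. s\<^sup>2 * u s)"
    by (rule integral_subset_le[OF _ int int]) (use r A_infty_nonneg[OF u] in auto)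
  then show "P u r \<le> 1" unfolding P_eq[OF u r] A_infty_mass[OF u] .
qed

text \<open>A lower bound for the metric function, uniform over all profiles: the full mass
  \<open>M2\<close> placed at the smallest radius \<open>R1\<close>.\<close>

abbreviation "Fmin \<equiv> 1 - 2 * M2 / R1"

lemma Fmin_pos: "Fmin > 0"
  using R1_gt R1_pos by (simp add: field_simps)

lemma
  assumes u: "u \<in> A_infty R1 R2" and r: "R1 \<le> r" "r \<le> R2"
  shows F_ge: "Fmin \<le> F u r" and F_le: "F u r \<le> 1 - 2 * M1 / r"
proof -
  have r0: "r > 0" using r R1_pos by linarith
  have dP: "0 \<le> (M2 - M1) * P u r"
    using M1_less_M2 P_nonneg[OF u r] by simp
  have "(M2 - M1) * P u r \<le> (M2 - M1) * 1"
    using M1_less_M2 P_le_1[OF u r] by (intro mult_left_mono) auto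
  then have "2 * (M1 + (M2 - M1) * P u r) \<le> 2 * M2" by (simp add: algebra_simps)
  then have "2 * (M1 + (M2 - M1) * P u r) / r \<le> 2 * M2 / R1"
    using r R1_pos M1_pos M1_less_M2 by (intro frac_le) auto
  then show "Fmin \<le> F u r" by (simp add: F_met_def)
  have "2 * M1 / r \<le> 2 * (M1 + (M2 - M1) * P u r) / r"
    using dP r0 by (intro divide_right_mono) auto
  then show "F u r \<le> 1 - 2 * M1 / r" by (simp add: F_met_def)
qed

lemma F_continuous: "u \<in> A_infty R1 R2 \<Longrightarrow> continuous_on {R1..R2} (F u)"
  unfolding F_met_def [abs_def] using R1_pos by (auto intro!: continuous_intros P_continuous)

section \<open>Comparison of the integrand with the positive part of the slope\<close>

abbreviation "rise u r \<equiv> max (deriv u r) 0"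

lemma rise_continuous: "u \<in> A_infty R1 R2 \<Longrightarrow> continuous_on S (rise u)"
  by (intro continuous_intros A_infty_deriv_continuous)

definition weight :: "(real \<Rightarrow> real) \<Rightarrow> real \<Rightarrow> real" where
  "weight u r = r ^ 3 * rise u r / sqrt (F u r)"

lemma weight_continuous:
  assumes u: "u \<in> A_infty R1 R2"
  shows "continuous_on {R1..R2} (weight u)"
proof -
  have "F u r \<noteq> 0" if "r \<in> {R1..R2}" for r using F_ge[OF u, of r] Fmin_pos that by auto
  then show ?thesis unfolding weight_def [abs_def]
    by (intro continuous_intros rise_continuous F_continuous u) auto
qed

lemma I_fun_eq: "u \<in> A_infty R1 R2 \<Longrightarrow> I_fun M1 M2 R1 R2 u = integral {R1..R2} (weight u)"
  unfolding I_fun_def weight_def [symmetric]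
  by (rule set_lborel_integral_continuous[OF weight_continuous])

text \<open>The lower bound discards the shell mass, the upper bound inserts \<open>Fmin\<close>.
  Neither comparison factor depends on \<open>u\<close>, so the estimates hold uniformly along a
  sequence.\<close>

lemma
  assumes u: "u \<in> A_infty R1 R2" and r: "R1 \<le> r" "r \<le> R2"
  shows weight_nonneg: "weight u r \<ge> 0" and weight_ge: "weight u r \<ge> q r * rise u r"
    and weight_le: "weight u r \<le> R2 ^ 3 / sqrt Fmin * rise u r"
proof -
  have pos: "r > 0" "F u r > 0" using F_ge[OF u r] Fmin_pos r R1_pos by linarith+
  show "weight u r \<ge> 0" using pos by (simp add: weight_def)
  have "r ^ 3 / sqrt (1 - 2 * M1 / r) \<le> r ^ 3 / sqrt (F u r)"
    using pos F_le[OF u r] by (intro frac_le) auto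
  then have "q r \<le> r ^ 3 / sqrt (F u r)" using q_eq[of r] r R1_gt1 by simp
  then have "q r * rise u r \<le> r ^ 3 / sqrt (F u r) * rise u r" by (intro mult_right_mono) auto
  then show "weight u r \<ge> q r * rise u r" by (simp add: weight_def)
  have "r ^ 3 / sqrt (F u r) \<le> R2 ^ 3 / sqrt Fmin"
    using pos F_ge[OF u r] Fmin_pos r by (intro frac_le power_mono) auto
  then have "r ^ 3 / sqrt (F u r) * rise u r \<le> R2 ^ 3 / sqrt Fmin * rise u r"
    by (intro mult_right_mono) auto
  then show "weight u r \<le> R2 ^ 3 / sqrt Fmin * rise u r" by (simp add: weight_def)
qed

text \<open>Integration by parts: \<open>A * u\<close> has zero boundary values, so the unit mass
  equals the integral of \<open>A\<close> times the slope. Since \<open>A\<close> is nonnegative,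
  replacing the slope by its positive part can only enlarge it.\<close>

lemma integral_A_rise_ge:
  assumes u: "u \<in> A_infty R1 R2"
  shows "integral {R1..R2} (\<lambda>r. A r * rise u r) \<ge> 1"
proof -
  have "((\<lambda>r. A r * u r) has_vector_derivative (A r * deriv u r - r\<^sup>2 * u r)) (at r within {R1..R2})" for r
    unfolding has_real_derivative_iff_has_vector_derivative [symmetric]
    by (rule has_field_derivative_at_within, rule DERIV_cong)
      (rule DERIV_mult[OF A_deriv A_infty_deriv[OF u]], simp)
  then have "((\<lambda>r. A r * deriv u r - r\<^sup>2 * u r) has_integral (A R2 * u R2 - A R1 * u R1)) {R1..R2}"
    using R1_less_R2 by (intro fundamental_theorem_of_calculus) auto
  then have "integral {R1..R2} (\<lambda>r. A r * deriv u r - r\<^sup>2 * u r) = 0"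
    using A_infty_R1[OF u] A_infty_R2[OF u] by (simp add: integral_unique)
  moreover have int: "(\<lambda>r. A r * deriv u r) integrable_on {R1..R2}"
    "(\<lambda>r. r\<^sup>2 * u r) integrable_on {R1..R2}" "(\<lambda>r. A r * rise u r) integrable_on {R1..R2}"
    by (intro integrable_continuous_real continuous_intros A_continuous rise_continuous
        A_infty_continuous A_infty_deriv_continuous u)+
  ultimately have "integral {R1..R2} (\<lambda>r. A r * deriv u r) = 1"
    using A_infty_mass[OF u] by (simp add: Henstock_Kurzweil_Integration.integral_diff)
  moreover have "A r * deriv u r \<le> A r * rise u r" if "r \<in> {R1..R2}" for r
    using that R1_pos by (intro mult_left_mono) (auto simp: A_fun_def power_mono)
  then have "integral {R1..R2} (\<lambda>r. A r * deriv u r) \<le> integral {R1..R2} (\<lambda>r. A r * rise u r)"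
    by (intro integral_le int)
  ultimately show ?thesis by simp
qed

text \<open>The quantitative form of the lower bound: nonnegativity of the left side gives
  \<open>I_fun_ge\<close>, while an excess tending to zero forces concentration.\<close>

lemma integral_gap_rise_le:
  assumes u: "u \<in> A_infty R1 R2"
  shows "integral {R1..R2} (\<lambda>r. gap r * rise u r) \<le> I_fun M1 M2 R1 R2 u - lam"
proof -
  have int: "(\<lambda>r. q r * rise u r) integrable_on {R1..R2}"
    "(\<lambda>r. lam * (A r * rise u r)) integrable_on {R1..R2}" "weight u integrable_on {R1..R2}"
    by (intro integrable_continuous_real continuous_intros A_continuous rise_continuous q_continuous
        weight_continuous u)+
  have "integral {R1..R2} (\<lambda>r. gap r * rise u r)
      = integral {R1..R2} (\<lambda>r. q r * rise u r - lam * (A r * rise u r))"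
    by (simp add: gap_def algebra_simps)
  also have "\<dots> = integral {R1..R2} (\<lambda>r. q r * rise u r)
      - lam * integral {R1..R2} (\<lambda>r. A r * rise u r)"
    using int by (simp add: Henstock_Kurzweil_Integration.integral_diff)
  also have "\<dots> \<le> integral {R1..R2} (weight u) - lam * 1"
    using integral_A_rise_ge[OF u] lam_pos weight_ge[OF u]
    by (intro diff_mono integral_le int mult_left_mono) auto
  finally show ?thesis by (simp add: I_fun_eq[OF u])
qed

lemma I_fun_ge:
  assumes u: "u \<in> A_infty R1 R2"
  shows "I_fun M1 M2 R1 R2 u \<ge> lam"
proof -
  have "integral {R1..R2} (\<lambda>r. gap r * rise u r) \<ge> 0"
    by (intro integral_nonneg integrable_continuous_real continuous_intros gap_continuous
        rise_continuous u) (auto intro!: mult_nonneg_nonneg gap_nonneg)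
  then show ?thesis using integral_gap_rise_le[OF u] by simp
qed

text \<open>Continuity at \<open>a\<close> gives \<eta> nearby. Away from \<open>a\<close> the gap
  is bounded below by compactness, so a multiple of it dominates the oscillation.\<close>

lemma oscillation_le_gap:
  assumes \<phi>: "continuous_on {R1..R2} \<phi>" and \<eta>: "\<eta> > (0::real)"
  obtains B where "B \<ge> 0" "\<And>r. r \<in> {R1..R2} \<Longrightarrow> \<bar>\<phi> r - \<phi> a\<bar> \<le> \<eta> + B * gap r"
proof -
  have "a \<in> {R1..R2}" using a_bounds by simp
  then obtain d where d: "d > 0" "\<And>r. r \<in> {R1..R2} \<Longrightarrow> dist r a < d \<Longrightarrow> dist (\<phi> r) (\<phi> a) < \<eta>"
    using \<phi> \<eta> unfolding continuous_on_iff by meson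
  define K where "K = {R1..R2} - ball a d"
  have "compact K" unfolding K_def by (intro compact_diff) auto
  have K: "r \<in> {R1..R2}" "r \<noteq> a" if "r \<in> K" for r using that d(1) by (auto simp: K_def)
  have cont: "continuous_on K (\<lambda>r. \<bar>\<phi> r - \<phi> a\<bar> / gap r)"
    using K(1) gap_pos K(2)
    by (intro continuous_intros continuous_on_subset[OF \<phi>] continuous_on_subset[OF gap_continuous])
      (auto simp: less_le)
  then have "bounded ((\<lambda>r. \<bar>\<phi> r - \<phi> a\<bar> / gap r) ` K)"
    using \<open>compact K\<close> by (intro compact_imp_bounded compact_continuous_image)
  then obtain B where B: "B > 0" "\<And>r. r \<in> K \<Longrightarrow> \<bar>\<bar>\<phi> r - \<phi> a\<bar> / gap r\<bar> \<le> B"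
    unfolding bounded_pos by auto
  show thesis
  proof
    show "B \<ge> 0" using B by simp
    fix r assume r: "r \<in> {R1..R2}"
    then have g: "gap r \<ge> 0" using gap_nonneg by simp
    show "\<bar>\<phi> r - \<phi> a\<bar> \<le> \<eta> + B * gap r"
    proof (cases "r \<in> K")
      case True
      then have "gap r > 0" using gap_pos K by auto
      then have "\<bar>\<phi> r - \<phi> a\<bar> \<le> B * gap r" using B(2)[OF True] by (simp add: divide_simps)
      then show ?thesis using \<eta> by simp
    next
      case False
      then have "dist (\<phi> r) (\<phi> a) < \<eta>" using r d(2) by (simp add: K_def dist_commute)
      moreover have "B * gap r \<ge> 0" using g B(1) by simp
      ultimately show ?thesis by (simp only: dist_real_def)
    qed
  qed
qed

text \<open>The pointwise oscillation bound is integrated against \<open>weight u\<close>: the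
  constant \<eta> produces a multiple of the functional, and the gap term, after bounding the weight
  by the rise, is controlled by the excess over \<open>lam\<close>.\<close>

lemma weight_concentration:
  assumes u: "u \<in> A_infty R1 R2" and \<phi>: "continuous_on {R1..R2} \<phi>"
    and B: "B \<ge> 0" "\<And>r. r \<in> {R1..R2} \<Longrightarrow> \<bar>\<phi> r - \<phi> a\<bar> \<le> \<eta> + B * gap r"
  shows "\<bar>integral {R1..R2} (\<lambda>r. weight u r * \<phi> r) - \<phi> a * I_fun M1 M2 R1 R2 u\<bar>
     \<le> \<eta> * I_fun M1 M2 R1 R2 u + B * (R2 ^ 3 / sqrt Fmin) * (I_fun M1 M2 R1 R2 u - lam)"
proof -
  define C where "C = R2 ^ 3 / sqrt Fmin"
  have "C \<ge> 0" using R2_pos Fmin_pos by (simp add: C_def)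
  have int: "(\<lambda>r. weight u r * \<phi> r) integrable_on {R1..R2}"
    "(\<lambda>r. \<phi> a * weight u r) integrable_on {R1..R2}"
    "(\<lambda>r. weight u r * (\<phi> r - \<phi> a)) integrable_on {R1..R2}"
    "(\<lambda>r. \<eta> * weight u r) integrable_on {R1..R2}"
    "(\<lambda>r. (B * C) * (gap r * rise u r)) integrable_on {R1..R2}"
    "(\<lambda>r. \<eta> * weight u r + (B * C) * (gap r * rise u r)) integrable_on {R1..R2}"
    by (intro integrable_continuous_real continuous_intros rise_continuous weight_continuous
        gap_continuous u \<phi>)+
  have eq: "integral {R1..R2} (\<lambda>r. weight u r * \<phi> r) - \<phi> a * I_fun M1 M2 R1 R2 u
      = integral {R1..R2} (\<lambda>r. weight u r * (\<phi> r - \<phi> a))"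
    using Henstock_Kurzweil_Integration.integral_diff[OF int(1,2)] I_fun_eq[OF u]
    by (simp add: algebra_simps)
  have "\<bar>integral {R1..R2} (\<lambda>r. weight u r * (\<phi> r - \<phi> a))\<bar>
      \<le> integral {R1..R2} (\<lambda>r. \<eta> * weight u r + (B * C) * (gap r * rise u r))"
    unfolding real_norm_def [symmetric]
  proof (rule integral_norm_bound_integral[OF int(3,6)])
    fix r assume r: "r \<in> {R1..R2}"
    then have w: "0 \<le> weight u r" "weight u r \<le> C * rise u r" and g: "gap r \<ge> 0"
      using weight_nonneg[OF u] weight_le[OF u] gap_nonneg by (auto simp: C_def)
    have "norm (weight u r * (\<phi> r - \<phi> a)) = weight u r * \<bar>\<phi> r - \<phi> a\<bar>"
      using w(1) by (simp add: abs_mult)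
    also have "\<dots> \<le> weight u r * (\<eta> + B * gap r)" by (intro mult_left_mono B r w)
    also have "\<dots> = \<eta> * weight u r + weight u r * (B * gap r)" by (simp add: algebra_simps)
    also have "weight u r * (B * gap r) \<le> (C * rise u r) * (B * gap r)"
      using w g B(1) by (intro mult_right_mono) auto
    also have "\<dots> = (B * C) * (gap r * rise u r)" by simp
    finally show "norm (weight u r * (\<phi> r - \<phi> a)) \<le> \<eta> * weight u r + (B * C) * (gap r * rise u r)"
      by simp
  qed
  also have "\<dots> = \<eta> * I_fun M1 M2 R1 R2 u + (B * C) * integral {R1..R2} (\<lambda>r. gap r * rise u r)"
    unfolding Henstock_Kurzweil_Integration.integral_add[OF int(4,5)] I_fun_eq[OF u]
    by (simp only: integral_mult_right)
  also have "\<dots> \<le> \<eta> * I_fun M1 M2 R1 R2 u + (B * C) * (I_fun M1 M2 R1 R2 u - lam)"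
    using \<open>C \<ge> 0\<close> B(1) by (intro add_left_mono mult_left_mono integral_gap_rise_le u) auto
  finally show ?thesis unfolding eq C_def .
qed

section \<open>Integration against \<open>Xi\<close> and weak-star convergence\<close>

lemma Xi_integral:
  assumes u: "u \<in> A_infty R1 R2" and \<phi>: "continuous_on {R1..R2} \<phi>"
  shows "(\<integral>r. \<phi> r \<partial>Xi M1 M2 R1 R2 u)
     = (M2 - M1) / 2 * integral {R1..R2} (\<lambda>r. weight u r * \<phi> r)"
proof -
  let ?M = "restrict_space lborel {R1..R2}"
  have meas: "f \<in> borel_measurable ?M" if "continuous_on {R1..R2} f" for f :: "real \<Rightarrow> real"
    using borel_measurable_continuous_on_restrict[OF that]
    by (simp add: measurable_cong_sets[OF sets_restrict_space_cong[OF sets_lborel] refl])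
  have "(\<integral>r. \<phi> r \<partial>Xi M1 M2 R1 R2 u) = (\<integral>r. ((M2 - M1) / 2 * weight u r) *\<^sub>R \<phi> r \<partial>?M)"
    unfolding Xi_def weight_def [symmetric]
  proof (rule integral_density)
    show "AE r in ?M. 0 \<le> (M2 - M1) / 2 * weight u r"
      by (rule AE_I2) (use M1_less_M2 weight_nonneg[OF u] in \<open>auto simp: space_restrict_space\<close>)
  qed (intro meas continuous_intros weight_continuous u \<phi>)+
  also have "\<dots> = (LBINT r:{R1..R2}. (M2 - M1) / 2 * (weight u r * \<phi> r))"
    by (subst integral_restrict_space) (simp_all add: set_lebesgue_integral_def mult_ac)
  also have "\<dots> = integral {R1..R2} (\<lambda>r. (M2 - M1) / 2 * (weight u r * \<phi> r))"
    by (intro set_lborel_integral_continuous continuous_intros weight_continuous u \<phi>)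
  finally show ?thesis by simp
qed

lemma scaled_dirac_integral:
  assumes \<phi>: "continuous_on {R1..R2} \<phi>" and c: "c \<ge> 0"
  shows "(\<integral>r. \<phi> r \<partial>scale_measure (ennreal c) (dirac_on {R1..R2} a)) = c * \<phi> a"
proof -
  let ?N = "restrict_space borel {R1..R2} :: real measure"
  have a: "a \<in> space ?N" using a_bounds by (simp add: space_restrict_space)
  have meas: "\<phi> \<in> borel_measurable ?N" by (rule borel_measurable_continuous_on_restrict[OF \<phi>])
  \<comment> \<open>As a constant density over a point mass, the scaled measure falls under the rule
    for integrals of densities.\<close>
  have "scale_measure (ennreal c) (dirac_on {R1..R2} a) = density (return ?N a) (\<lambda>_. ennreal c)"
    by (rule measure_eqI) (simp_all add: dirac_on_def emeasure_density_const)
  then show ?thesis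
    using meas a c by (simp add: integral_density integral_return)
qed

lemma Xi_weak_star:
  assumes u: "\<And>n. u n \<in> A_infty R1 R2" and lim: "(\<lambda>n. I_fun M1 M2 R1 R2 (u n)) \<longlonglongrightarrow> lam"
  shows "weak_star_tendsto {R1..R2} (\<lambda>n. Xi M1 M2 R1 R2 (u n))
     (scale_measure (ennreal ((M2 - M1) / 2 * lam)) (dirac_on {R1..R2} a))"
  unfolding weak_star_tendsto_def
proof (intro allI impI)
  fix \<phi> :: "real \<Rightarrow> real" assume \<phi>: "continuous_on {R1..R2} \<phi>"
  define I where "I n = I_fun M1 M2 R1 R2 (u n)" for n
  define J where "J n = integral {R1..R2} (\<lambda>r. weight (u n) r * \<phi> r)" for n
  have I: "I \<longlonglongrightarrow> lam" using lim by (simp add: I_def [abs_def])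
  have "(\<lambda>n. J n - \<phi> a * I n) \<longlonglongrightarrow> 0"
  proof (rule LIMSEQ_I)
    fix e :: real assume "e > 0"
    \<comment> \<open>With this choice the upper bound tends to \<open>e / 2\<close>, because its
      excess term vanishes in the limit.\<close>
    define \<eta> where "\<eta> = e / (2 * lam)"
    have "\<eta> > 0" using \<open>e > 0\<close> lam_pos by (simp add: \<eta>_def)
    with \<phi> obtain B where B: "B \<ge> 0" "\<And>r. r \<in> {R1..R2} \<Longrightarrow> \<bar>\<phi> r - \<phi> a\<bar> \<le> \<eta> + B * gap r"
      using oscillation_le_gap by metis
    define D where "D = B * (R2 ^ 3 / sqrt Fmin)"
    have "(\<lambda>n. \<eta> * I n + D * (I n - lam)) \<longlonglongrightarrow> \<eta> * lam + D * (lam - lam)"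
      by (intro tendsto_intros I)
    moreover have "\<eta> * lam + D * (lam - lam) < e" using \<open>e > 0\<close> lam_pos by (simp add: \<eta>_def)
    ultimately have "eventually (\<lambda>n. \<eta> * I n + D * (I n - lam) < e) sequentially"
      by (rule order_tendstoD)
    moreover have "\<bar>J n - \<phi> a * I n\<bar> \<le> \<eta> * I n + D * (I n - lam)" for n
      unfolding I_def J_def D_def by (rule weight_concentration[OF u \<phi> B])
    ultimately have "eventually (\<lambda>n. norm (J n - \<phi> a * I n - 0) < e) sequentially"
      by (auto elim!: eventually_mono intro: le_less_trans)
    then show "\<exists>N. \<forall>n\<ge>N. norm (J n - \<phi> a * I n - 0) < e" by (simp add: eventually_sequentially)
  qed
  then have "(\<lambda>n. (M2 - M1) / 2 * ((J n - \<phi> a * I n) + \<phi> a * I n))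
      \<longlonglongrightarrow> (M2 - M1) / 2 * (0 + \<phi> a * lam)"
    by (intro tendsto_intros I)
  moreover have "(\<integral>r. \<phi> r \<partial>scale_measure (ennreal ((M2 - M1) / 2 * lam)) (dirac_on {R1..R2} a))
      = (M2 - M1) / 2 * (0 + \<phi> a * lam)"
    using scaled_dirac_integral[OF \<phi>, of "(M2 - M1) / 2 * lam"] M1_less_M2 lam_pos by simp
  ultimately show "(\<lambda>n. \<integral>r. \<phi> r \<partial>Xi M1 M2 R1 R2 (u n)) \<longlonglongrightarrow>
     (\<integral>r. \<phi> r \<partial>scale_measure (ennreal ((M2 - M1) / 2 * lam)) (dirac_on {R1..R2} a))"
    by (simp only: Xi_integral[OF u \<phi>] J_def diff_add_cancel)
qed

end

section \<open>Minimizing sequences\<close>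

context mass_shell
begin

text \<open>The trial profile is a normalized box smoothed to rise on [a + e, a + 2e] and fall on
  [R2 - 2e, R2 - e]. \<open>D\<close> is the mass of its plateau before normalization, and
  \<open>Fe\<close> bounds the metric function from below on the rising layer, where little mass has
  accumulated.\<close>

lemma exists_I_fun_le:
  fixes e :: real
  defines "D \<equiv> ((R2 - 2 * e) ^ 3 - (a + 2 * e) ^ 3) / 3"
  defines "Fe \<equiv> 1 - 2 * (M1 + (M2 - M1) * (2 * e * R2\<^sup>2 / D)) / a"
  assumes e: "e > 0" "4 * e < R2 - a" and Fe: "Fe > 0"
  shows "\<exists>u\<in>A_infty R1 R2. I_fun M1 M2 R1 R2 u \<le> (a + 2 * e) ^ 3 / (D * sqrt Fe)"
proof -
  \<comment> \<open>The arguments are \<open>(r - a - e) / e\<close> and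
    \<open>(R2 - r - e) / e\<close>, written in the affine form that \<open>ndiff_affine\<close>
    expects.\<close>
  define up down where "up r = smooth_step ((1 / e) * r + (- a / e - 1))"
    and "down r = smooth_step ((- 1 / e) * r + (R2 / e - 1))" for r
  define v where "v r = up r * down r" for r
  obtain s where s: "\<And>x. (smooth_step has_real_derivative s x) (at x)" "\<And>x. s x \<ge> 0"
    "continuous_on UNIV s" "\<And>x. x \<notin> {0..1} \<Longrightarrow> s x = 0"
    by (rule smooth_step_has_derivative) blast
  define up' down' where "up' r = s ((1 / e) * r + (- a / e - 1)) * (1 / e)"
    and "down' r = s ((- 1 / e) * r + (R2 / e - 1)) * (- 1 / e)" for r
  have up_deriv: "(up has_real_derivative up' r) (at r)" for r
    unfolding up_def [abs_def] up'_def
    using e by (intro DERIV_chain2[OF s(1)]) (auto intro!: derivative_eq_intros)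
  have down_deriv: "(down has_real_derivative down' r) (at r)" for r
    unfolding down_def [abs_def] down'_def
    using e by (intro DERIV_chain2[OF s(1)]) (auto intro!: derivative_eq_intros)
  have up01: "0 \<le> up r" "up r \<le> 1" and down01: "0 \<le> down r" "down r \<le> 1" for r
    by (simp_all add: up_def down_def smooth_step_nonneg smooth_step_le_1)
  have v01: "0 \<le> v r" "v r \<le> 1" for r
    using up01[of r] down01[of r] by (auto simp: v_def intro: mult_le_one)
  have args: "(1 / e) * r + (- a / e - 1) = (r - a - e) / e"
    "(- 1 / e) * r + (R2 / e - 1) = (R2 - r - e) / e" for r
    using e by (simp_all add: field_simps)
  have v0: "v r = 0" if "r \<notin> {a + e..R2 - e}" for r
  proof -
    have "(1 / e) * r + (- a / e - 1) \<le> 0 \<or> (- 1 / e) * r + (R2 / e - 1) \<le> 0"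
      unfolding args using that e by (auto simp: divide_le_0_iff)
    then show ?thesis by (auto simp: v_def up_def down_def smooth_step_eq_0)
  qed
  have v1: "v r = 1" if "r \<in> {a + 2 * e..R2 - 2 * e}" for r
  proof -
    have "(1 / e) * r + (- a / e - 1) \<ge> 1" "(- 1 / e) * r + (R2 / e - 1) \<ge> 1"
      unfolding args using that e by (auto simp: le_divide_eq)
    then show ?thesis by (simp add: v_def up_def down_def smooth_step_eq_1)
  qed
  have v_deriv: "(v has_real_derivative up' r * down r + down' r * up r) (at r)" for r
    unfolding v_def [abs_def] by (rule DERIV_mult[OF up_deriv down_deriv])
  have v_cont: "continuous_on S v" for S
    using v_deriv by (auto intro!: continuous_at_imp_continuous_on intro: DERIV_isCont)
  have v_int: "(\<lambda>r. r\<^sup>2 * v r) integrable_on {x..y}" for x y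
    by (intro integrable_continuous_real continuous_intros v_cont)
  define N where "N = integral {R1..R2} (\<lambda>r. r\<^sup>2 * v r)"
  have a0: "a > 0" "R1 \<le> a" using a_bounds by auto
  have "a + 2 * e < R2 - 2 * e" using e by simp
  then have D_pos: "D > 0"
    unfolding D_def using power_strict_mono[of "a + 2 * e" "R2 - 2 * e" 3] a0 e by simp
  have "((\<lambda>r. r ^ 3 / 3) has_vector_derivative r\<^sup>2) (at r within S)" for r :: real and S
    unfolding has_real_derivative_iff_has_vector_derivative [symmetric]
    by (rule has_field_derivative_at_within) (auto intro!: derivative_eq_intros)
  then have "((\<lambda>r. r\<^sup>2) has_integral ((R2 - 2 * e) ^ 3 / 3 - (a + 2 * e) ^ 3 / 3)) {a + 2 * e..R2 - 2 * e}"
    using \<open>a + 2 * e < R2 - 2 * e\<close> by (intro fundamental_theorem_of_calculus) auto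
  then have "D = integral {a + 2 * e..R2 - 2 * e} (\<lambda>r. r\<^sup>2)"
    by (simp add: D_def integral_unique diff_divide_distrib)
  also have "\<dots> = integral {a + 2 * e..R2 - 2 * e} (\<lambda>r. r\<^sup>2 * v r)"
    by (rule Henstock_Kurzweil_Integration.integral_cong) (simp add: v1)
  also have "\<dots> \<le> N"
    \<comment> \<open>Dropping everything outside the plateau bounds the normalizing constant
      \<open>N\<close> from below by \<open>D\<close>.\<close>
    unfolding N_def by (rule integral_subset_le[OF _ v_int v_int]) (use a0 e v01 in auto)
  finally have N: "D \<le> N" "N > 0" using D_pos by auto
  define u where "u r = (1 / N) * v r" for r
  have u_bound: "0 \<le> u r" "u r \<le> 1 / D" for r
  proof -
    have "(1 / N) * v r \<le> (1 / D) * 1"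
      using N D_pos v01[of r] by (intro mult_mono divide_left_mono) auto
    then show "0 \<le> u r" "u r \<le> 1 / D" using N v01[of r] by (auto simp: u_def)
  qed
  have u: "u \<in> A_infty R1 R2"
    unfolding A_infty_def
  proof (intro CollectI conjI allI)
    show "(deriv ^^ k) u differentiable at x" for k x
      unfolding u_def [abs_def] v_def [abs_def] up_def [abs_def] down_def [abs_def]
      by (intro ndiff_imp_differentiable ndiff_mult ndiff_const
          ndiff_affine[OF ndiff_smooth_step])
    show "u r \<ge> 0" for r by (rule u_bound)
    have "closure {r. u r \<noteq> 0} \<subseteq> {a + e..R2 - e}"
      using v0 by (intro closure_minimal) (auto simp: u_def simp del: atLeastAtMost_iff)
    then show "closure {r. u r \<noteq> 0} \<subseteq> {R1<..<R2}" using a0 e by fastforce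
    have "continuous_on {R1..R2} (\<lambda>r. r\<^sup>2 * u r)"
      unfolding u_def by (intro continuous_intros v_cont)
    then have "(LBINT r:{R1..R2}. r\<^sup>2 * u r) = integral {R1..R2} (\<lambda>r. r\<^sup>2 * u r)"
      by (rule set_lborel_integral_continuous)
    also have "\<dots> = integral {R1..R2} (\<lambda>r. (1 / N) * (r\<^sup>2 * v r))"
      by (simp add: u_def)
    also have "\<dots> = (1 / N) * N" unfolding N_def by (rule integral_mult_right)
    finally show "(LBINT r:{R1..R2}. r\<^sup>2 * u r) = 1" using N by simp
  qed
  have u_int: "(\<lambda>r. r\<^sup>2 * u r) integrable_on {x..y}" for x y
    by (intro integrable_continuous_real continuous_intros A_infty_continuous u)
  have up'_nonneg: "up' r \<ge> 0" and down'_nonpos: "down' r \<le> 0" for r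
    using s(2) e by (auto simp: up'_def down'_def)
  have u_deriv: "deriv u r = (1 / N) * (up' r * down r + down' r * up r)" for r
    unfolding u_def [abs_def] by (rule DERIV_imp_deriv) (rule DERIV_cmult[OF v_deriv])
  have rise_le: "rise u r \<le> (1 / D) * up' r" for r
  proof -
    \<comment> \<open>The falling factor contributes only a nonpositive term, so the rise comes from
      \<open>up'\<close> alone.\<close>
    have "up' r * down r + down' r * up r \<le> up' r * 1 + 0"
      using up'_nonneg[of r] down'_nonpos[of r] up01[of r] down01[of r]
      by (intro add_mono mult_left_mono mult_nonpos_nonneg) auto
    then have "deriv u r \<le> (1 / N) * up' r"
      unfolding u_deriv using N by (intro mult_left_mono) auto
    also have "\<dots> \<le> (1 / D) * up' r"
      using N D_pos up'_nonneg by (intro mult_right_mono divide_left_mono) auto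
    finally show ?thesis using D_pos up'_nonneg[of r] by simp
  qed
  have P_le: "P u r \<le> 2 * e * R2\<^sup>2 / D" if r: "a \<le> r" "r \<le> a + 2 * e" for r
  proof -
    have "r \<le> R2" using r e by linarith
    have "P u r = integral {R1..r} (\<lambda>t. t\<^sup>2 * u t)"
      using \<open>r \<le> R2\<close> r a0 by (intro P_eq u) auto
    also have "\<dots> = integral {R1..a} (\<lambda>t. t\<^sup>2 * u t) + integral {a..r} (\<lambda>t. t\<^sup>2 * u t)"
      using a0 r
      by (intro Henstock_Kurzweil_Integration.integral_combine [symmetric] u_int) auto
    also have "integral {R1..a} (\<lambda>t. t\<^sup>2 * u t) = integral {R1..a} (\<lambda>t. 0)"
      using v0 e by (intro Henstock_Kurzweil_Integration.integral_cong) (auto simp: u_def)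
    also have "\<dots> + integral {a..r} (\<lambda>t. t\<^sup>2 * u t) = integral {a..r} (\<lambda>t. t\<^sup>2 * u t)" by simp
    also have "\<dots> \<le> integral {a..r} (\<lambda>t. R2\<^sup>2 * (1 / D))"
    proof (rule integral_le[OF u_int])
      fix t assume "t \<in> {a..r}"
      then show "t\<^sup>2 * u t \<le> R2\<^sup>2 * (1 / D)"
        using u_bound[of t] a0 \<open>r \<le> R2\<close> D_pos by (intro mult_mono power_mono) auto
    qed auto
    also have "\<dots> = (r - a) * (R2\<^sup>2 * (1 / D))" using r by simp
    also have "\<dots> \<le> (2 * e) * (R2\<^sup>2 * (1 / D))" using r D_pos by (intro mult_right_mono) auto
    finally show ?thesis by simp
  qed
  define K where "K = (a + 2 * e) ^ 3 / (D * sqrt Fe)"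
  have "K \<ge> 0" using a0 e D_pos Fe by (simp add: K_def)
  have weight_le: "weight u r \<le> K * up' r" if r: "r \<in> {R1..R2}" for r
  proof (cases "r \<in> {a + e..a + 2 * e}")
    case False
    \<comment> \<open>Outside the rising layer the step is constant, so the weight vanishes and no
      bound on the metric function is required.\<close>
    then have "(r - a - e) / e \<notin> {0..1}" using e by (auto simp: zero_le_divide_iff divide_le_eq)
    then have "up' r = 0" unfolding up'_def args by (simp add: s(4))
    then have "rise u r = 0" using rise_le[of r] by simp
    then show ?thesis using \<open>up' r = 0\<close> by (simp add: weight_def)
  next
    case True
    then have ar: "a \<le> r" "r \<le> a + 2 * e" using e by auto
    define d where "d = (M2 - M1) * (2 * e * R2\<^sup>2 / D)"
    have "(M2 - M1) * P u r \<le> d"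
      unfolding d_def using M1_less_M2 P_le[OF ar] by (intro mult_left_mono) auto
    then have "2 * (M1 + (M2 - M1) * P u r) / r \<le> 2 * (M1 + d) / a"
      using ar a0 M1_pos M1_less_M2 e D_pos by (intro frac_le) (auto simp: d_def)
    then have F: "F u r \<ge> Fe" by (simp add: F_met_def Fe_def d_def)
    have "weight u r = r ^ 3 / sqrt (F u r) * rise u r" by (simp add: weight_def)
    also have "\<dots> \<le> ((a + 2 * e) ^ 3 / sqrt Fe) * ((1 / D) * up' r)"
      using F Fe ar a0 rise_le[of r] by (intro mult_mono frac_le power_mono) auto
    also have "\<dots> = K * up' r" by (simp add: K_def)
    finally show ?thesis .
  qed
  have up'_cont: "continuous_on {R1..R2} up'"
    unfolding up'_def [abs_def]
    by (intro continuous_intros continuous_on_compose2[OF s(3)]) auto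
  \<comment> \<open>The total increase of \<open>up\<close> is at most one, so \<open>K\<close>
    alone bounds the functional.\<close>
  have "(up' has_integral (up R2 - up R1)) {R1..R2}"
    using R1_less_R2 up_deriv
    by (intro fundamental_theorem_of_calculus)
      (auto simp: has_real_derivative_iff_has_vector_derivative [symmetric]
        intro: has_field_derivative_at_within)
  then have up'_int: "integral {R1..R2} up' \<le> 1"
    using up01[of R1] up01[of R2] by (simp add: integral_unique)
  have "I_fun M1 M2 R1 R2 u = integral {R1..R2} (weight u)" by (rule I_fun_eq[OF u])
  also have "\<dots> \<le> integral {R1..R2} (\<lambda>r. K * up' r)"
    by (intro integral_le integrable_continuous_real weight_continuous u continuous_intros
        up'_cont weight_le)
  also have "\<dots> = K * integral {R1..R2} up'" by (rule integral_mult_right)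
  also have "\<dots> \<le> K * 1" using up'_int \<open>K \<ge> 0\<close> by (intro mult_left_mono)
  finally show ?thesis using u by (auto simp: K_def)
qed

text \<open>As \<open>e\<close> decreases to zero, \<open>D e\<close> tends to \<open>A a\<close>
  and \<open>Fe e\<close> to \<open>1 - 2 * M1 / a\<close>, so the bound on the trial profiles tends
  to \<open>q a / A a\<close>, which is \<open>lam\<close>.\<close>

lemma exists_I_fun_less:
  assumes "\<epsilon> > 0"
  shows "\<exists>u\<in>A_infty R1 R2. I_fun M1 M2 R1 R2 u < lam + \<epsilon>"
proof -
  define D where "D e = ((R2 - 2 * e) ^ 3 - (a + 2 * e) ^ 3) / 3" for e
  define Fe where "Fe e = 1 - 2 * (M1 + (M2 - M1) * (2 * e * R2\<^sup>2 / D e)) / a" for e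
  have A: "A a > 0" using A_pos a_bounds by simp
  have Fa: "1 - 2 * M1 / a > 0" using a_bounds by (simp add: field_simps)
  have "(D \<longlongrightarrow> ((R2 - 2 * 0) ^ 3 - (a + 2 * 0) ^ 3) / 3) (at_right 0)"
    unfolding D_def [abs_def] by (intro tendsto_intros) auto
  then have D: "(D \<longlongrightarrow> A a) (at_right 0)" by (simp add: A_fun_def)
  have "(Fe \<longlongrightarrow> 1 - 2 * (M1 + (M2 - M1) * (2 * 0 * R2\<^sup>2 / A a)) / a) (at_right 0)"
    unfolding Fe_def [abs_def] using A a_bounds by (intro tendsto_intros D) auto
  then have Fe: "(Fe \<longlongrightarrow> 1 - 2 * M1 / a) (at_right 0)" by simp
  have "((\<lambda>e. (a + 2 * e) ^ 3 / (D e * sqrt (Fe e))) \<longlongrightarrow>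
      (a + 2 * 0) ^ 3 / (A a * sqrt (1 - 2 * M1 / a))) (at_right 0)"
    using A Fa by (intro tendsto_intros D Fe) auto
  moreover have "(a + 2 * 0) ^ 3 / (A a * sqrt (1 - 2 * M1 / a)) = lam"
    using a_bounds by (simp add: lambda_star_def Psi_def q_eq mult.commute)
  ultimately have "eventually (\<lambda>e. (a + 2 * e) ^ 3 / (D e * sqrt (Fe e)) < lam + \<epsilon>) (at_right 0)"
    using assms by (intro order_tendstoD(2)[where y = lam]) auto
  moreover have "eventually (\<lambda>e. Fe e > 0) (at_right 0)"
    using Fe Fa by (rule order_tendstoD)
  moreover have "eventually (\<lambda>e. e \<in> {0<..<(R2 - a) / 4}) (at_right 0)"
    using a_bounds by (intro eventually_at_right_real) auto
  ultimately have "eventually (\<lambda>e. (a + 2 * e) ^ 3 / (D e * sqrt (Fe e)) < lam + \<epsilon> \<and> Fe e > 0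
      \<and> e \<in> {0<..<(R2 - a) / 4}) (at_right 0)"
    by (intro eventually_conj)
  then obtain e where e: "(a + 2 * e) ^ 3 / (D e * sqrt (Fe e)) < lam + \<epsilon>" "Fe e > 0" "e > 0" "4 * e < R2 - a"
    using eventually_happens'[OF trivial_limit_at_right_real] by fastforce
  obtain u where "u \<in> A_infty R1 R2" "I_fun M1 M2 R1 R2 u \<le> (a + 2 * e) ^ 3 / (D e * sqrt (Fe e))"
    using exists_I_fun_le[OF e(3,4)] e(2) unfolding D_def Fe_def by blast
  then show ?thesis using e(1) by force
qed

lemma INF_I_fun: "(INF u\<in>A_infty R1 R2. I_fun M1 M2 R1 R2 u) = lam"
proof (rule antisym)
  have bdd: "bdd_below (I_fun M1 M2 R1 R2 ` A_infty R1 R2)"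
    using I_fun_ge by (intro bdd_belowI2[where m = lam]) auto
  show "(INF u\<in>A_infty R1 R2. I_fun M1 M2 R1 R2 u) \<le> lam"
  proof (rule field_le_epsilon)
    fix \<epsilon> :: real assume "\<epsilon> > 0"
    then obtain u where "u \<in> A_infty R1 R2" "I_fun M1 M2 R1 R2 u < lam + \<epsilon>"
      using exists_I_fun_less by blast
    then show "(INF u\<in>A_infty R1 R2. I_fun M1 M2 R1 R2 u) \<le> lam + \<epsilon>"
      using cINF_lower[OF bdd] by fastforce
  qed
  have "A_infty R1 R2 \<noteq> {}" using exists_I_fun_less[of 1] by auto
  then show "lam \<le> (INF u\<in>A_infty R1 R2. I_fun M1 M2 R1 R2 u)"
    by (rule cINF_greatest) (rule I_fun_ge)
qed

end

section \<open>The Israel layer of a static metric\<close>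

definition diag_mat :: "('n \<Rightarrow> real) \<Rightarrow> real^'n^'n" where
  "diag_mat d = (\<chi> i j. if i = j then d i else 0)"

lemma diag_mat_nth [simp]: "diag_mat d $ i $ j = (if i = j then d i else 0)"
  by (simp add: diag_mat_def)

lemma diag_mat_mult: "diag_mat d ** diag_mat e = diag_mat (\<lambda>i. d i * e i)"
proof -
  have "(\<Sum>k\<in>UNIV. diag_mat d $ i $ k * diag_mat e $ k $ j) = diag_mat (\<lambda>i. d i * e i) $ i $ j" for i j
  proof -
    have "diag_mat d $ i $ k * diag_mat e $ k $ j
        = (if k = i then diag_mat (\<lambda>i. d i * e i) $ i $ j else 0)" for k by simp
    then show ?thesis by simp
  qed
  then show ?thesis by (simp add: vec_eq_iff matrix_matrix_mult_def)
qed

lemma matrix_inv_unique: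
  fixes A B :: "real^'n^'n"
  assumes "A ** B = mat 1" "B ** A = mat 1"
  shows "matrix_inv A = B"
proof -
  \<comment> \<open>\<open>matrix_inv\<close> is a choice, and \<open>B\<close> witnesses that the
    chosen matrix really is a two-sided inverse; associativity then identifies it with
    \<open>B\<close>.\<close>
  have "A ** matrix_inv A = mat 1 \<and> matrix_inv A ** A = mat 1"
    unfolding matrix_inv_def by (rule someI[of _ B]) (simp add: assms)
  then have "matrix_inv A = matrix_inv A ** (A ** B)" "(matrix_inv A ** A) ** B = B"
    by (simp_all add: assms)
  then show ?thesis by (simp add: matrix_mul_assoc)
qed

lemma matrix_inv_diag_mat:
  assumes "\<And>i. d i \<noteq> 0"
  shows "matrix_inv (diag_mat d) = diag_mat (\<lambda>i. inverse (d i))"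
proof (rule matrix_inv_unique)
  have "diag_mat (\<lambda>i. 1) = (mat 1 :: real^'n^'n)" by (simp add: vec_eq_iff mat_def)
  then show "diag_mat d ** diag_mat (\<lambda>i. inverse (d i)) = mat 1"
    "diag_mat (\<lambda>i. inverse (d i)) ** diag_mat d = mat 1"
    using assms by (simp_all add: diag_mat_mult)
qed

section \<open>Extrinsic curvature of spheres in a static metric\<close>

definition metric_coeff :: "(real \<Rightarrow> real) \<Rightarrow> real^4 \<Rightarrow> 4 \<Rightarrow> real" where
  "metric_coeff F x \<mu> = (if \<mu> = 1 then - F (x$2) else if \<mu> = 2 then 1 / F (x$2)
     else if \<mu> = 3 then (x$2)\<^sup>2 else (x$2)\<^sup>2 * (sin (x$3))\<^sup>2)"

lemma static_metric_diag: "static_metric F x = diag_mat (metric_coeff F x)"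
  by (simp add: vec_eq_iff static_metric_def metric_coeff_def)

lemma partial_const: "partial \<mu> (\<lambda>z. c) x = 0"
  by (simp add: partial_def)

lemma lower_unit_normal:
  "lower_index (static_metric F) (unit_normal F) x $ \<nu> = (if \<nu> = 2 then sqrt (F (x$2)) / F (x$2) else 0)"
  by (simp add: lower_index_def matrix_vector_mult_def unit_normal_def static_metric_diag
      axis_def metric_coeff_def if_distrib[of "\<lambda>t. _ * t"] cong: if_cong)

text \<open>The normal covector has only a radial component, so in tangential directions just the
  Christoffel symbol with upper radial index contributes. The result is half the derivative of the
  metric along the unit normal.\<close>

lemma cov_deriv_normal:
  assumes F: "F (x$2) > 0" and x: "x$2 > 0" "sin (x$3) \<noteq> 0" and \<mu>: "\<mu> \<noteq> 2" "\<nu> \<noteq> 2"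
  shows "cov_deriv (static_metric F) (lower_index (static_metric F) (unit_normal F)) x $ \<mu> $ \<nu>
     = sqrt (F (x$2)) / 2 * partial 2 (\<lambda>z. static_metric F z $ \<mu> $ \<nu>) x"
proof -
  have inv: "matrix_inv (static_metric F x) = diag_mat (\<lambda>i. inverse (metric_coeff F x i))"
    unfolding static_metric_diag using F x by (intro matrix_inv_diag_mat) (simp add: metric_coeff_def)
  have chr: "christoffel (static_metric F) x 2 \<mu> \<nu>
      = - F (x$2) * partial 2 (\<lambda>z. static_metric F z $ \<mu> $ \<nu>) x / 2"
  proof -
    let ?T = "\<lambda>\<rho>. partial \<mu> (\<lambda>z. static_metric F z $ \<rho> $ \<nu>) x
      + partial \<nu> (\<lambda>z. static_metric F z $ \<rho> $ \<mu>) x - partial \<rho> (\<lambda>z. static_metric F z $ \<mu> $ \<nu>) x"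
    have "christoffel (static_metric F) x 2 \<mu> \<nu>
        = (\<Sum>\<rho>\<in>(UNIV :: 4 set). (if \<rho> = 2 then F (x$2) * ?T 2 else 0)) / 2"
      unfolding christoffel_def inv
      by (intro arg_cong2[where f = "(/)"] sum.cong) (simp_all add: metric_coeff_def)
    also have "\<dots> = F (x$2) * ?T 2 / 2" by simp
    \<comment> \<open>The other two terms differentiate mixed radial-tangential entries, which
      vanish identically.\<close>
    also have "?T 2 = - partial 2 (\<lambda>z. static_metric F z $ \<mu> $ \<nu>) x"
      using \<mu> by (simp add: static_metric_diag partial_const)
    finally show ?thesis by simp
  qed
  have "(\<Sum>\<kappa>\<in>UNIV. christoffel (static_metric F) x \<kappa> \<mu> \<nu>
        * lower_index (static_metric F) (unit_normal F) x $ \<kappa>)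
      = (\<Sum>\<kappa>\<in>(UNIV :: 4 set). if \<kappa> = 2 then christoffel (static_metric F) x 2 \<mu> \<nu> * (sqrt (F (x$2)) / F (x$2)) else 0)"
    by (intro sum.cong) (auto simp: lower_unit_normal)
  also have "\<dots> = - (sqrt (F (x$2)) / 2 * partial 2 (\<lambda>z. static_metric F z $ \<mu> $ \<nu>) x)"
    using F by (simp add: chr)
  finally show ?thesis
    using \<mu> by (simp add: cov_deriv_def lower_unit_normal partial_const)
qed

lemma partial_radial_metric:
  assumes F: "(F has_real_derivative F') (at (x$2))" and \<mu>: "\<mu> \<noteq> 2"
  shows "partial 2 (\<lambda>z. static_metric F z $ \<mu> $ \<nu>) x = (if \<mu> = \<nu> then
     if \<mu> = 1 then - F' else if \<mu> = 3 then 2 * x$2 else 2 * x$2 * (sin (x$3))\<^sup>2 else 0)"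
proof (cases "\<mu> = \<nu>")
  case False
  then show ?thesis by (simp add: static_metric_diag partial_const)
next
  case True
  have "((\<lambda>s. F (x$2 + s)) has_real_derivative F' * 1) (at 0)"
    by (rule DERIV_chain2) (use F in \<open>auto intro!: derivative_eq_intros\<close>)
  then have 1: "deriv (\<lambda>s. - F (x$2 + s)) 0 = - F'"
    by (intro DERIV_imp_deriv) (auto intro: DERIV_minus)
  have 2: "deriv (\<lambda>s. (x$2 + s)\<^sup>2) 0 = 2 * x$2"
    by (rule DERIV_imp_deriv) (auto intro!: derivative_eq_intros)
  have 3: "deriv (\<lambda>s. (x$2 + s)\<^sup>2 * (sin (x$3))\<^sup>2) 0 = 2 * x$2 * (sin (x$3))\<^sup>2"
    by (rule DERIV_imp_deriv) (auto intro!: derivative_eq_intros)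
  show ?thesis
    using \<mu> 1 2 3 True by (auto simp: partial_def static_metric_diag metric_coeff_def axis_def)
qed

definition frame_index :: "3 \<Rightarrow> 4" where
  "frame_index A = (if A = 1 then 1 else if A = 2 then 3 else 4)"

definition frame_scale :: "(real \<Rightarrow> real) \<Rightarrow> real \<Rightarrow> 3 \<Rightarrow> real" where
  "frame_scale F c A = (if A = 1 then 1 / sqrt (F c) else 1)"

text \<open>Every tangent vector is a multiple of one coordinate vector, so a single term of the
  double sum survives.\<close>

lemma frame_contract:
  fixes C :: "real^4^4"
  shows "(\<Sum>\<mu>\<in>UNIV. \<Sum>\<nu>\<in>UNIV. tangent_frame F c $ A $ \<mu> * tangent_frame F c $ B $ \<nu> * C $ \<mu> $ \<nu>)
    = frame_scale F c A * frame_scale F c B * C $ frame_index A $ frame_index B"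
proof -
  have frame: "tangent_frame F c $ A $ \<mu> = (if \<mu> = frame_index A then frame_scale F c A else 0)" for A \<mu>
    by (simp add: tangent_frame_def frame_index_def frame_scale_def axis_def)
  have "tangent_frame F c $ A $ \<mu> * tangent_frame F c $ B $ \<nu> * C $ \<mu> $ \<nu>
    = (if \<nu> = frame_index B then (if \<mu> = frame_index A then
        frame_scale F c A * frame_scale F c B * C $ frame_index A $ frame_index B else 0) else 0)" for \<mu> \<nu>
    by (simp add: frame)
  then show ?thesis by simp
qed

lemma frame_index_neq_2: "frame_index A \<noteq> 2"
  by (simp add: frame_index_def)

lemma frame_index_eq_iff: "frame_index A = frame_index B \<longleftrightarrow> A = B"
  using exhaust_3[of A] exhaust_3[of B] by (auto simp: frame_index_def)

text \<open>The slope of the metric function is a separate argument \<open>D\<close>, so that its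
  one-sided limits can be inserted at a kink. The frame is normalized at \<open>c\<close> while the
  derivative is taken at \<open>r\<close>, hence both \<open>F c\<close> and \<open>F r\<close>
  occur.\<close>

definition static_curv :: "(real \<Rightarrow> real) \<Rightarrow> real \<Rightarrow> real^3 \<Rightarrow> real \<Rightarrow> real \<Rightarrow> real^3^3" where
  "static_curv F c y r D = diag_mat (\<lambda>A. if A = 1 then - (sqrt (F r) * D / (2 * (sqrt (F c))\<^sup>2))
     else if A = 2 then r * sqrt (F r) else r * sqrt (F r) * (sin (y$2))\<^sup>2)"

lemma ext_curv_static:
  assumes F: "(F has_real_derivative F') (at r)" "F r > 0" and r: "r > 0"
    and y: "sin (y$2) \<noteq> 0"
  shows "ext_curv F c y r = static_curv F c y r F'"
proof -
  define x where "x = layer_point F c y r"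
  have x: "x$2 = r" "x$3 = y$2" by (simp_all add: x_def layer_point_def)
  let ?C = "cov_deriv (static_metric F) (lower_index (static_metric F) (unit_normal F)) x"
  have 1: "ext_curv F c y r $ A $ B
      = frame_scale F c A * frame_scale F c B * ?C $ frame_index A $ frame_index B" for A B
    unfolding ext_curv_def x_def [symmetric] by (simp add: frame_contract)
  have 2: "?C $ frame_index A $ frame_index B = sqrt (F r) / 2 * (if A = B then
     if frame_index A = 1 then - F' else if frame_index A = 3 then 2 * r else 2 * r * (sin (y$2))\<^sup>2 else 0)" for A B
    using cov_deriv_normal[of F x "frame_index A" "frame_index B"]
      partial_radial_metric[of F F' x "frame_index A" "frame_index B"] frame_index_neq_2 F r y
    by (simp add: x frame_index_eq_iff)
  show ?thesis
    by (simp add: static_curv_def vec_eq_iff 1 2) (simp add: frame_index_def frame_scale_def power2_eq_square)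
qed

lemma induced_metric_static:
  assumes "F c > 0"
  shows "induced_metric F c y = diag_mat (\<lambda>A. if A = 1 then - 1 else if A = 2 then c\<^sup>2 else c\<^sup>2 * (sin (y$2))\<^sup>2)"
proof -
  have 1: "induced_metric F c y $ A $ B = frame_scale F c A * frame_scale F c B
      * static_metric F (layer_point F c y c) $ frame_index A $ frame_index B" for A B
    unfolding induced_metric_def by (simp add: frame_contract)
  have "sqrt (F c) * sqrt (F c) = F c" using assms by simp
  then show ?thesis using assms
    by (simp add: vec_eq_iff 1 static_metric_diag frame_index_eq_iff)
      (simp add: frame_index_def frame_scale_def metric_coeff_def layer_point_def)
qed

lemma surface_stress_diag:
  assumes "\<And>A. h A \<noteq> 0"
  shows "surface_stress (diag_mat h) (diag_mat k) (diag_mat l)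
    = diag_mat (\<lambda>A. ((\<Sum>B\<in>UNIV. (k B - l B) / h B) - (k A - l A) / h A) / (8 * pi))"
proof -
  have "matrix_inv (diag_mat h) ** diag_mat k - matrix_inv (diag_mat h) ** diag_mat l
      = diag_mat (\<lambda>A. (k A - l A) / h A)"
    using assms by (simp add: matrix_inv_diag_mat diag_mat_mult vec_eq_iff field_simps)
  then show ?thesis
    by (simp add: surface_stress_def trace_def vec_eq_iff mat_def field_simps)
qed

lemma tendsto_diag_mat:
  assumes "\<And>i. ((\<lambda>x. d x i) \<longlongrightarrow> e i) G"
  shows "((\<lambda>x. diag_mat (d x)) \<longlongrightarrow> diag_mat e) G"
  using assms by (intro vec_tendstoI) simp

text \<open>A general \<open>S\<close> lets one statement serve for both sides of the
  hypersurface.\<close>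

lemma ext_curv_tendsto:
  assumes F: "isCont F c" "F c > 0" and c: "c > 0" and y: "sin (y$2) \<noteq> 0"
    and F': "eventually (\<lambda>r. (F has_real_derivative F' r) (at r)) (at c within S)"
      "(F' \<longlongrightarrow> D) (at c within S)"
  shows "(ext_curv F c y \<longlongrightarrow> static_curv F c y c D) (at c within S)"
proof (rule Lim_transform_eventually)
  have lim: "(F \<longlongrightarrow> F c) (at c within S)" "((\<lambda>r. r) \<longlongrightarrow> c) (at c within S)"
    using F(1) by (auto simp: isCont_def intro: tendsto_within_subset tendsto_ident_at)
  show "((\<lambda>r. static_curv F c y r (F' r)) \<longlongrightarrow>
     static_curv F c y c D) (at c within S)"
    unfolding static_curv_def
  proof (rule tendsto_diag_mat)
    fix A :: 3
    show "((\<lambda>r. if A = 1 then - (sqrt (F r) * F' r / (2 * (sqrt (F c))\<^sup>2))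
     else if A = 2 then r * sqrt (F r) else r * sqrt (F r) * (sin (y$2))\<^sup>2) \<longlongrightarrow>
     (if A = 1 then - (sqrt (F c) * D / (2 * (sqrt (F c))\<^sup>2))
     else if A = 2 then c * sqrt (F c) else c * sqrt (F c) * (sin (y$2))\<^sup>2)) (at c within S)"
      using F(2) by (cases "A = 1"; cases "A = 2") (auto intro!: tendsto_intros lim F'(2))
  qed
  have "eventually (\<lambda>r. F r > 0) (at c within S)" using lim(1) F(2) by (rule order_tendstoD)
  moreover have "eventually (\<lambda>r. r > 0) (at c within S)" using lim(2) c by (rule order_tendstoD)
  ultimately show "eventually (\<lambda>r. static_curv F c y r (F' r) = ext_curv F c y r) (at c within S)"
    using F'(1)
  proof eventually_elim
    case (elim r)
    then show ?case using ext_curv_static[of F "F' r" r y c] y by simp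
  qed
qed

text \<open>The angular entries involve only the continuous \<open>F\<close> and cancel in the jump.
  The sole surviving entry of the mixed curvature jump is the time-time one, [F'] / (2 sqrt F);
  subtracting the trace leaves no surface energy and equal tangential pressures.\<close>

lemma israel_layer_static:
  assumes F: "isCont F c" "F c > 0" and c: "c > 0"
    and right: "eventually (\<lambda>r. (F has_real_derivative Fr r) (at r)) (at_right c)" "(Fr \<longlongrightarrow> Dr) (at_right c)"
    and left: "eventually (\<lambda>r. (F has_real_derivative Fl r) (at r)) (at_left c)" "(Fl \<longlongrightarrow> Dl) (at_left c)"
  shows "israel_layer F c 0 ((Dr - Dl) / (16 * pi * sqrt (F c)))"
  unfolding israel_layer_def
proof (intro conjI allI impI F)
  fix y :: "real^3" assume "0 < y$2 \<and> y$2 < pi"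
  then have "sin (y$2) > 0" by (simp add: sin_gt_zero)
  then have y: "sin (y$2) \<noteq> 0" by simp
  have stress: "surface_stress (induced_metric F c y)
      (static_curv F c y c Dr) (static_curv F c y c Dl)
     = (\<chi> A B. if A \<noteq> B then 0 else if A = 1 then - 0 else (Dr - Dl) / (16 * pi * sqrt (F c)))"
  proof -
    have "(- (w * Dr / (2 * w\<^sup>2)) - - (w * Dl / (2 * w\<^sup>2))) / (- 1) = (Dr - Dl) / (2 * w)"
      if "w > 0" for w :: real
      using that by (simp add: field_simps power2_eq_square)
    moreover have "sqrt (F c) > 0" using F by simp
    ultimately have "(- (sqrt (F c) * Dr / (2 * (sqrt (F c))\<^sup>2)) - - (sqrt (F c) * Dl / (2 * (sqrt (F c))\<^sup>2))) / (- 1)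
        = (Dr - Dl) / (2 * sqrt (F c))" by blast
    then show ?thesis
      unfolding induced_metric_static[of F, OF F(2)] static_curv_def
      using c y by (subst surface_stress_diag) (auto simp: vec_eq_iff sum_3)
  qed
  show "\<exists>Kp Km. (ext_curv F c y \<longlongrightarrow> Kp) (at_right c) \<and> (ext_curv F c y \<longlongrightarrow> Km) (at_left c) \<and>
      surface_stress (induced_metric F c y) Kp Km
        = (\<chi> A B. if A \<noteq> B then 0 else if A = 1 then - 0 else (Dr - Dl) / (16 * pi * sqrt (F c)))"
    using ext_curv_tendsto[OF F c y right] ext_curv_tendsto[OF F c y left] stress by blast
qed

context mass_shell
begin

section \<open>The inner layer of the box profile\<close>

lemma P_star_eq:
  assumes "r < R2"
  shows "P (u_star M1 R1 R2) r = H_star M1 R1 R2 * ((max r a) ^ 3 - a ^ 3) / 3"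
proof (cases "r < R1")
  case True
  then show ?thesis using a_bounds by (simp add: P_mass_def max_def)
next
  case False
  let ?H = "H_star M1 R1 R2"
  have "(LBINT s:{R1..r}. s\<^sup>2 * u_star M1 R1 R2 s) = (LBINT s:{a..max r a}. ?H * s\<^sup>2)"
    unfolding set_lebesgue_integral_def
  proof (rule integral_cong_AE)
    show "AE s in lborel. indicat_real {R1..r} s *\<^sub>R (s\<^sup>2 * u_star M1 R1 R2 s)
        = indicat_real {a..max r a} s *\<^sub>R (?H * s\<^sup>2)"
      \<comment> \<open>The integrands can differ only at \<open>s = a\<close>, the excluded left
        end of the box.\<close>
      using AE_lborel_singleton[of a]
      by eventually_elim (use assms a_bounds in \<open>auto simp: u_star_def indicator_def\<close>)
  qed (simp_all add: u_star_def)
  also have "\<dots> = ?H * (max r a) ^ 3 / 3 - ?H * a ^ 3 / 3"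
    unfolding set_lebesgue_integral_def
    by (rule integral_FTC_atLeastAtMost)
      (auto intro!: continuous_intros derivative_eq_intros
        simp: has_real_derivative_iff_has_vector_derivative [symmetric])
  finally show ?thesis using False assms by (simp add: P_mass_def field_simps)
qed

lemma israel_layer_star:
  "israel_layer (F_star M1 M2 R1 R2) a 0 (- ((M2 - M1) * H_star M1 R1 R2 * a) / (8 * pi * sqrt (1 - 2 * M1 / a)))"
proof -
  let ?F = "F_star M1 M2 R1 R2" and ?b = "(M2 - M1) * H_star M1 R1 R2"
  define G where "G r = 1 - 2 * (M1 + ?b * (r ^ 3 - a ^ 3) / 3) / r" for r
  define G' where "G' r = (2 * (M1 + ?b * (r ^ 3 - a ^ 3) / 3) - 2 * (?b * r\<^sup>2) * r) / r\<^sup>2" for r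
  have right: "?F r = G r" if "a \<le> r" "r < R2" for r
    using P_star_eq[of r] that by (simp add: F_star_def F_met_def G_def max_def)
  \<comment> \<open>This includes the case \<open>a = R1\<close>, because \<open>P_mass\<close> is
    extended by zero below \<open>R1\<close>.\<close>
  have left: "?F r = 1 - 2 * M1 / r" if "r \<le> a" for r
    using P_star_eq[of r] that a_bounds by (simp add: F_star_def F_met_def max_def)
  have Fa: "?F a = 1 - 2 * M1 / a" using left by simp
  have dF_right: "(?F has_real_derivative G' r) (at r)" if "a < r" "r < R2" for r
  proof -
    have "(G has_real_derivative G' r) (at r)"
      unfolding G_def [abs_def] G'_def using that a_bounds
      by (auto intro!: derivative_eq_intros simp: power2_eq_square minus_divide_left)
    then show ?thesis
      by (rule has_field_derivative_transform_within_open[where S = "{a<..<R2}"])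
        (use that right in auto)
  qed
  have dF_left: "(?F has_real_derivative 2 * M1 / r\<^sup>2) (at r)" if "0 < r" "r < a" for r
  proof -
    have "((\<lambda>r. 1 - 2 * M1 / r) has_real_derivative 2 * M1 / r\<^sup>2) (at r)"
      using that by (auto intro!: derivative_eq_intros simp: power2_eq_square)
    then show ?thesis
      by (rule has_field_derivative_transform_within_open[where S = "{..<a}"])
        (use that left in auto)
  qed
  have "eventually (\<lambda>r. r \<in> {a<..<R2}) (at_right a)" "eventually (\<lambda>r. r \<in> {0<..<a}) (at_left a)"
    using a_bounds by (blast intro: eventually_at_right_real eventually_at_left_real)+
  then have ev: "eventually (\<lambda>r. (?F has_real_derivative G' r) (at r)) (at_right a)"
    "eventually (\<lambda>r. (?F has_real_derivative 2 * M1 / r\<^sup>2) (at r)) (at_left a)"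
    "eventually (\<lambda>r. G r = ?F r) (at_right a)" "eventually (\<lambda>r. 1 - 2 * M1 / r = ?F r) (at_left a)"
    using dF_right dF_left right left by (auto elim!: eventually_mono)
  have "(G \<longlongrightarrow> 1 - 2 * (M1 + ?b * (a ^ 3 - a ^ 3) / 3) / a) (at_right a)"
    unfolding G_def [abs_def] using a_bounds by (intro tendsto_intros) auto
  then have 1: "(?F \<longlongrightarrow> ?F a) (at_right a)"
    using ev(3) by (simp add: Fa Lim_transform_eventually)
  have "((\<lambda>r. 1 - 2 * M1 / r) \<longlongrightarrow> 1 - 2 * M1 / a) (at_left a)"
    using a_bounds by (intro tendsto_intros) auto
  then have 2: "(?F \<longlongrightarrow> ?F a) (at_left a)"
    using ev(4) by (simp add: Fa Lim_transform_eventually)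
  have cont: "isCont ?F a" using 1 2 by (simp add: isCont_def filterlim_split_at)
  have pos: "?F a > 0" using a_bounds by (simp add: Fa field_simps)
  have "(G' \<longlongrightarrow> (2 * (M1 + ?b * (a ^ 3 - a ^ 3) / 3) - 2 * (?b * a\<^sup>2) * a) / a\<^sup>2) (at_right a)"
    unfolding G'_def [abs_def] using a_bounds by (intro tendsto_intros) auto
  moreover have "((\<lambda>r. 2 * M1 / r\<^sup>2) \<longlongrightarrow> 2 * M1 / a\<^sup>2) (at_left a)"
    using a_bounds by (intro tendsto_intros) auto
  ultimately have "israel_layer ?F a 0
     (((2 * (M1 + ?b * (a ^ 3 - a ^ 3) / 3) - 2 * (?b * a\<^sup>2) * a) / a\<^sup>2 - 2 * M1 / a\<^sup>2) / (16 * pi * sqrt (?F a)))"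
    using a_bounds by (intro israel_layer_static[OF cont pos _ ev(1) _ ev(2)])
  \<comment> \<open>The contributions of the interior mass \<open>M1\<close> to the two slopes
    agree, so the jump comes entirely from the box density just outside \<open>a\<close>.\<close>
  moreover have "(2 * (M1 + ?b * (a ^ 3 - a ^ 3) / 3) - 2 * (?b * a\<^sup>2) * a) / a\<^sup>2 - 2 * M1 / a\<^sup>2 = - 2 * (?b * a)"
    using a_bounds by (simp add: field_simps power2_eq_square)
  ultimately show ?thesis by (simp add: Fa mult_ac)
qed

text \<open>By \<open>q_eq\<close>, both sides equal (M2 - M1) / 2 times a^3 / (A(a) sqrt (1 - 2 M1
  / a)).\<close>

lemma lam_eq_pressure:
  "(M2 - M1) / 2 * lam
    = 4 * pi * a\<^sup>2 * (- (- ((M2 - M1) * H_star M1 R1 R2 * a) / (8 * pi * sqrt (1 - 2 * M1 / a))))"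
  using a_bounds
  by (simp add: lambda_star_def Psi_def q_eq H_star_def power2_eq_square power3_eq_cube mult_ac)

end

theorem theorem7p5:
  fixes M1 M2 R1 R2 :: real
  assumes "0 < M1" and "M1 < M2" and "R1 > 2 * M2" and "R2 > R1"
  shows "(\<forall>u :: nat \<Rightarrow> real \<Rightarrow> real.
            (\<forall>n. u n \<in> A_infty R1 R2) \<and>
            (\<lambda>n. I_fun M1 M2 R1 R2 (u n)) \<longlonglongrightarrow> lambda_star M1 R1 R2 \<longrightarrow>
            weak_star_tendsto {R1..R2} (\<lambda>n. Xi M1 M2 R1 R2 (u n))
              (scale_measure (ennreal ((M2 - M1) / 2 * lambda_star M1 R1 R2))
                 (dirac_on {R1..R2} (a_star M1 R1 R2))))
       \<and> (\<exists>\<sigma> p\<^sub>a. israel_layer (F_star M1 M2 R1 R2) (a_star M1 R1 R2) \<sigma> p\<^sub>a \<and>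
            (M2 - M1) / 2 * lambda_star M1 R1 R2 = 4 * pi * (a_star M1 R1 R2)\<^sup>2 * (- p\<^sub>a) \<and>
            (M2 - M1) / 2 * (INF u\<in>A_infty R1 R2. I_fun M1 M2 R1 R2 u)
              = 4 * pi * (a_star M1 R1 R2)\<^sup>2 * (- p\<^sub>a))"
proof -
  interpret mass_shell M1 M2 R1 R2 by unfold_locales (use assms in auto)
  show ?thesis
    unfolding INF_I_fun using Xi_weak_star israel_layer_star lam_eq_pressure by blast
qed

end
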